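(* Let $G$ be a virtually cyclic group. Then for every finite inverse-closed generating set $X$ of $G$ (with any total ordering of $X$), the set of shortlex conjugacy normal forms $\mathsf{ConjSL}(G,X)$ is regular, and hence the spherical conjugacy growth series $\widetilde{\sigma}(G,X)$ is a rational function.
   Context: Given a total ordering of $X$, the shortlex ordering on $X^*$ compares words first by length and then, for equal length, lexicographically. For each conjugacy class $c$ of $G$, $z_c$ denotes the shortlex least word over $X$ representing an element of $c$, and $\mathsf{ConjSL}(G,X)=\{z_c : c\text{ a conjugacy class of }G\}$. The spherical conjugacy growth series is $\widetilde{\sigma}(G,X)=\sum_{n\ge0}\phi(n)z^n$, where $\phi(n)$ is the number of words of length $n$ in $\mathsf{ConjSL}(G,X)$, equivalently the number of conjugacy classes of $G$ whose shortest elements have length $n$ over $X$. A language is regular if it is accepted by a finite state automaton. *)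

theory Defs
  imports "HOL-Algebra.Elementary_Groups" "HOL-Computational_Algebra.Polynomial_FPS"
begin

definition virtually_cyclic :: "('a, 'b) monoid_scheme \<Rightarrow> bool" where
  "virtually_cyclic G \<longleftrightarrow>
     (\<exists>H. subgroup H G \<and> cyclic_group (G\<lparr>carrier := H\<rparr>) \<and> finite (rcosets\<^bsub>G\<^esub> H))"

definition inverse_closed_gens :: "('a, 'b) monoid_scheme \<Rightarrow> 'a set \<Rightarrow> bool" where
  "inverse_closed_gens G X \<longleftrightarrow>
     X \<subseteq> carrier G \<and> (\<forall>x\<in>X. inv\<^bsub>G\<^esub> x \<in> X) \<and> generate G X = carrier G"

definition conj_class :: "('a, 'b) monoid_scheme \<Rightarrow> 'a \<Rightarrow> 'a set" where
  "conj_class G g = {h \<otimes>\<^bsub>G\<^esub> g \<otimes>\<^bsub>G\<^esub> inv\<^bsub>G\<^esub> h | h. h \<in> carrier G}"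

definition conj_classes :: "('a, 'b) monoid_scheme \<Rightarrow> 'a set set" where
  "conj_classes G = conj_class G ` carrier G"

definition word_value :: "('a, 'b) monoid_scheme \<Rightarrow> 'a list \<Rightarrow> 'a" where
  "word_value G w = foldr (\<lambda>x y. x \<otimes>\<^bsub>G\<^esub> y) w \<one>\<^bsub>G\<^esub>"

(* Total orderings are reflexive (linear_order_on), whereas lenlex expects the
   strict part of the ordering of the letters; shortlex is the strict order. *)
definition shortlex :: "('a \<times> 'a) set \<Rightarrow> ('a list \<times> 'a list) set" where
  "shortlex r = lenlex (r - Id)"

definition is_shortlex_least :: "('a \<times> 'a) set \<Rightarrow> 'a list set \<Rightarrow> 'a list \<Rightarrow> bool" where
  "is_shortlex_least r W w \<longleftrightarrow> w \<in> W \<and> (\<forall>v\<in>W. v \<noteq> w \<longrightarrow> (w, v) \<in> shortlex r)"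

(* The word z_c. The description is proper whenever X is finite, inverse-closed
   and generating and r linearly orders X; see is_shortlex_least_conj_nf below. *)
definition conj_nf ::
  "('a, 'b) monoid_scheme \<Rightarrow> 'a set \<Rightarrow> ('a \<times> 'a) set \<Rightarrow> 'a set \<Rightarrow> 'a list" where
  "conj_nf G X r c = (THE w. is_shortlex_least r {v \<in> lists X. word_value G v \<in> c} w)"

definition ConjSL ::
  "('a, 'b) monoid_scheme \<Rightarrow> 'a set \<Rightarrow> ('a \<times> 'a) set \<Rightarrow> 'a list set" where
  "ConjSL G X r = conj_nf G X r ` conj_classes G"

(* Acceptance by a complete deterministic automaton with state set Q, initial state i,
   transition function d and accepting states F. Every finite state set can be
   relabelled by natural numbers, so taking the states in nat is no restriction. *)
definition regular_lang :: "'a set \<Rightarrow> 'a list set \<Rightarrow> bool" where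
  "regular_lang A L \<longleftrightarrow> finite A \<and>
     (\<exists>(Q :: nat set) i d F. finite Q \<and> i \<in> Q \<and> F \<subseteq> Q \<and>
        (\<forall>q\<in>Q. \<forall>a\<in>A. d q a \<in> Q) \<and>
        L = {w \<in> lists A. foldl d i w \<in> F})"

definition spherical_conj_growth_series ::
  "('a, 'b) monoid_scheme \<Rightarrow> 'a set \<Rightarrow> ('a \<times> 'a) set \<Rightarrow> rat fps" where
  "spherical_conj_growth_series G X r =
     Abs_fps (\<lambda>n. of_nat (card {w \<in> ConjSL G X r. length w = n}))"

(* f = p/q is stated without division: on power series (/) is a truncated
   division when the constant coefficient of q vanishes. *)
definition rational_fps :: "'a::field fps \<Rightarrow> bool" where
  "rational_fps f \<longleftrightarrow> (\<exists>p q. q \<noteq> 0 \<and> f * fps_of_poly q = fps_of_poly p)"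

lemma word_value_surj:
  assumes "group G" and "inverse_closed_gens G X" "g \<in> carrier G"
  shows "\<exists>w\<in>lists X. word_value G w = g"
proof -
  interpret group G by fact
  have X: "X \<subseteq> carrier G" "\<And>x. x \<in> X \<Longrightarrow> inv\<^bsub>G\<^esub> x \<in> X" "g \<in> generate G X"
    using assms by (auto simp: inverse_closed_gens_def)
  have closed: "word_value G w \<in> carrier G" if "w \<in> lists X" for w
    using that X(1) by (induction w) (auto simp: word_value_def)
  have app: "word_value G (v @ w) = word_value G v \<otimes>\<^bsub>G\<^esub> word_value G w"
    if "v \<in> lists X" "w \<in> lists X" for v w
    using that
  proof (induction v)
    case Nil
    then show ?case using closed by (simp add: word_value_def)
  next
    case (Cons a v)
    then have "word_value G v \<in> carrier G" "word_value G w \<in> carrier G" "a \<in> carrier G"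
      using closed X(1) by auto
    with Cons show ?case by (simp add: word_value_def m_assoc)
  qed
  have single: "word_value G [x] = x" if "x \<in> X" for x
    using that X(1) by (auto simp: word_value_def)
  from X(3) show ?thesis
  proof (induction rule: generate.induct)
    case one
    then show ?case by (intro bexI[of _ "[]"]) (auto simp: word_value_def)
  next
    case (incl h)
    then show ?case using single by (intro bexI[of _ "[h]"]) auto
  next
    case (inv h)
    then show ?case using single X(2) by (intro bexI[of _ "[inv\<^bsub>G\<^esub> h]"]) auto
  next
    case (eng h1 h2)
    then obtain v w where "v \<in> lists X" "word_value G v = h1" "w \<in> lists X" "word_value G w = h2"
      by auto
    then show ?case using app by (intro bexI[of _ "v @ w"]) auto
  qed
qed

lemma ex1_shortlex_least:
  assumes "finite X" "linear_order_on X r" "W \<subseteq> lists X" "W \<noteq> {}"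
  shows "\<exists>!w. is_shortlex_least r W w"
proof -
  define s where "s = (r - Id) \<inter> X \<times> X"
  have r: "trans r" "antisym r" "total_on X r"
    using assms(2) by (auto simp: order_on_defs)
  have ts: "trans s"
    unfolding s_def
  proof (rule transI)
    fix x y z
    assume "(x, y) \<in> (r - Id) \<inter> X \<times> X" "(y, z) \<in> (r - Id) \<inter> X \<times> X"
    then show "(x, z) \<in> (r - Id) \<inter> X \<times> X"
      using transD[OF r(1), of x y z] antisymD[OF r(2), of x y] by auto
  qed
  have "irrefl s" by (auto simp: s_def irrefl_def)
  then have "acyclic s" using ts by (simp add: acyclic_irrefl)
  moreover have "finite s" using assms(1) by (auto simp: s_def intro: finite_subset)
  ultimately have wfs: "wf s" by (rule finite_acyclic_wf[rotated])
  have sl: "(v, w) \<in> shortlex r \<longleftrightarrow> (v, w) \<in> lenlex s" if "v \<in> lists X" "w \<in> lists X" for v w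
    using that
  proof (induction v arbitrary: w)
    case Nil
    then show ?case by (simp add: shortlex_def)
  next
    case (Cons a v)
    then show ?case
      by (cases w) (auto simp: shortlex_def Cons_lenlex_iff s_def)
  qed
  have tot: "(v, w) \<in> lenlex s \<or> (w, v) \<in> lenlex s"
    if "v \<in> lists X" "w \<in> lists X" "v \<noteq> w" for v w
    using that
  proof (induction v arbitrary: w)
    case Nil
    then show ?case by simp
  next
    case (Cons a v)
    show ?case
    proof (cases w)
      case Nil
      then show ?thesis by simp
    next
    case w: (Cons b u)
    consider "a = b" | "(a, b) \<in> s" | "(b, a) \<in> s"
      using Cons.hyps Cons.prems w r(3) by (auto simp: s_def total_on_def)
    then show ?thesis
    proof cases
      case 1
      with Cons.IH[of u] Cons.prems w show ?thesis
        by (auto simp: Cons_lenlex_iff)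
    qed (use w in \<open>auto simp: Cons_lenlex_iff\<close>)
    qed
  qed
  have wfl: "wf (lenlex s)" using wfs by (rule wf_lenlex)
  obtain w where w: "w \<in> W" "\<And>v. (v, w) \<in> lenlex s \<Longrightarrow> v \<notin> W"
    using wfE_min'[OF wfl assms(4)] by blast
  show ?thesis
  proof (rule ex1I)
    show "is_shortlex_least r W w"
      unfolding is_shortlex_least_def
    proof (intro conjI ballI impI)
      show "w \<in> W" by (fact w(1))
    next
      fix v assume v: "v \<in> W" "v \<noteq> w"
      then have "v \<in> lists X" "w \<in> lists X" using w(1) assms(3) by auto
      then show "(w, v) \<in> shortlex r" using tot[of w v] sl[of w v] w(2)[of v] v by auto
    qed
  next
    fix v assume v: "is_shortlex_least r W v"
    show "v = w"
    proof (rule ccontr)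
      assume "v \<noteq> w"
      with v w(1) have "(v, w) \<in> shortlex r" "v \<in> W" by (auto simp: is_shortlex_least_def)
      moreover from this have "v \<in> lists X" "w \<in> lists X" using w(1) assms(3) by auto
      ultimately show False using w(2)[of v] sl[of v w] by auto
    qed
  qed
qed

lemma is_shortlex_least_conj_nf:
  assumes "group G" "finite X" "inverse_closed_gens G X" "linear_order_on X r"
    and "c \<in> conj_classes G"
  shows "is_shortlex_least r {v \<in> lists X. word_value G v \<in> c} (conj_nf G X r c)"
proof -
  interpret group G by fact
  obtain g where g: "g \<in> carrier G" "c = conj_class G g"
    using assms(5) by (auto simp: conj_classes_def)
  then have "g = \<one>\<^bsub>G\<^esub> \<otimes>\<^bsub>G\<^esub> g \<otimes>\<^bsub>G\<^esub> inv\<^bsub>G\<^esub> \<one>\<^bsub>G\<^esub>" by simp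
  then have "g \<in> c"
    unfolding g(2) conj_class_def using one_closed by blast
  moreover obtain w where "w \<in> lists X" "word_value G w = g"
    using word_value_surj[OF assms(1,3) g(1)] by auto
  ultimately have "{v \<in> lists X. word_value G v \<in> c} \<noteq> {}" by auto
  then have "\<exists>!w. is_shortlex_least r {v \<in> lists X. word_value G v \<in> c} w"
    by (intro ex1_shortlex_least[OF assms(2,4)]) auto
  then show ?thesis
    unfolding conj_nf_def by (rule theI')
qed

end

theory Submission
  imports Defs
begin

text \<open>An infinite virtually cyclic group has an element \<open>z\<close> of infinite order generating a subgroup of
  finite index with \<open>g\<^sup>-\<^sup>1 z g \<in> {z, z\<^sup>-\<^sup>1}\<close> for all \<open>g\<close>. The elements that invert \<open>z\<close> form finitely many
  conjugacy classes and contribute a finite set of normal forms. Two elements centralizing \<open>z\<close> that are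
  conjugate are conjugate by one of finitely many elements \<open>t\<close>. So if a word \<open>w\<close> for an element
  centralizing \<open>z\<close> is not a normal form, then either some prefix is not the least word for its value, or
  \<open>w\<close> is geodesic and a smaller geodesic word represents \<open>t\<^sup>-\<^sup>1 w t\<close>. The group looks like a line, so
  in both cases the two paths stay synchronously at bounded distance, and a finite automaton that
  remembers the displacements of all candidates detects \<open>w\<close>.\<close>

section \<open>Regular languages\<close>

text \<open>Two obstacles shape the argument. Conjugators are unbounded, so a finite automaton
  cannot try them all; but the inverse of a conjugator is \<open>z [^] n \<otimes> t\<close> with
  \<open>t\<close> from a finite set, and when \<open>w\<close> commutes with \<open>z\<close> the
  power of \<open>z\<close> cancels. Moreover, paths are forced to stay close only if both are
  geodesic, while an input word may be far from geodesic. The shortest prefix that is not least for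
  its value is one letter longer than a geodesic, so detecting it still compares two geodesics, with
  ends at distance at most 1. Both kinds of witness thus have ends within one bound
  \<open>k\<close>, and this fixes the width \<open>R\<close> of the search.\<close>

lemma regular_langI:
  fixes Q :: "'q set"
  assumes "finite A" "finite Q" "i \<in> Q"
    and closed: "\<And>q a. q \<in> Q \<Longrightarrow> a \<in> A \<Longrightarrow> d q a \<in> Q"
    and L: "L = {w \<in> lists A. foldl d i w \<in> F}"
  shows "regular_lang A L"
proof -
  \<comment> \<open>\<open>regular_lang\<close> asks for states in \<open>nat\<close>; an injection
    of \<open>Q\<close> transports the automaton. Only \<open>F \<inter> Q\<close> is carried over,
    so \<open>F\<close> may contain points outside \<open>Q\<close>.\<close>
  obtain f :: "'q \<Rightarrow> nat" where inj: "inj_on f Q"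
    using finite_imp_inj_to_nat_seg[OF assms(2)] by auto
  define g where "g = the_inv_into Q f"
  have gf: "g (f q) = q" if "q \<in> Q" for q
    using the_inv_into_f_f[OF inj that] by (simp add: g_def)
  define d' where "d' n a = f (d (g n) a)" for n a
  have run: "foldl d q w \<in> Q \<and> foldl d' (f q) w = f (foldl d q w)"
    if "w \<in> lists A" "q \<in> Q" for w q
    using that by (induction w arbitrary: q) (auto simp: d'_def gf closed)
  show ?thesis
    unfolding regular_lang_def
  proof (intro conjI exI)
    show "finite A" by fact
    show "finite (f ` Q)" using assms(2) by simp
    show "f i \<in> f ` Q" using assms(3) by simp
    show "f ` (F \<inter> Q) \<subseteq> f ` Q" by auto
    show "\<forall>q\<in>f ` Q. \<forall>a\<in>A. d' q a \<in> f ` Q" by (auto simp: d'_def gf closed)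
    show "L = {w \<in> lists A. foldl d' (f i) w \<in> f ` (F \<inter> Q)}"
    proof -
      have "foldl d i w \<in> F \<longleftrightarrow> foldl d' (f i) w \<in> f ` (F \<inter> Q)" if "w \<in> lists A" for w
        using run[OF that assms(3)] inj by (auto simp: inj_on_def)
      then show ?thesis unfolding L by blast
    qed
  qed
qed

text \<open>Product automaton. The free Boolean function \<open>b\<close> makes union, intersection
  and difference instances of one construction.\<close>

lemma regular_lang_combine:
  assumes "regular_lang A L" "regular_lang A M"
  shows "regular_lang A {w \<in> lists A. b (w \<in> L) (w \<in> M)}"
proof -
  obtain Q :: "nat set" and i d F where 1: "finite A" "finite Q" "i \<in> Q"
    "\<forall>q\<in>Q. \<forall>a\<in>A. d q a \<in> Q" "L = {w \<in> lists A. foldl d i w \<in> F}"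
    using assms(1) unfolding regular_lang_def by blast
  obtain Q' :: "nat set" and i' d' F' where 2: "finite Q'" "i' \<in> Q'"
    "\<forall>q\<in>Q'. \<forall>a\<in>A. d' q a \<in> Q'" "M = {w \<in> lists A. foldl d' i' w \<in> F'}"
    using assms(2) unfolding regular_lang_def by blast
  have run: "foldl (\<lambda>(q, q') a. (d q a, d' q' a)) (q, q') w = (foldl d q w, foldl d' q' w)" for q q' w
    by (induction w arbitrary: q q') auto
  have "{w \<in> lists A. b (w \<in> L) (w \<in> M)} = {w \<in> lists A.
      foldl (\<lambda>(q, q') a. (d q a, d' q' a)) (i, i') w \<in> {(q, q'). b (q \<in> F) (q' \<in> F')}}"
    unfolding 1(5) 2(4) run by (intro Collect_cong conj_cong refl) simp
  then show ?thesis
    by (rule regular_langI[where Q = "Q \<times> Q'", rotated -1]) (use 1 2 in auto)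
qed

lemma regular_lang_some_prefix:
  assumes "regular_lang A L"
  shows "regular_lang A {w \<in> lists A. \<exists>n. take n w \<in> L}"
proof -
  obtain Q :: "nat set" and i d F where 1: "finite A" "finite Q" "i \<in> Q"
    "\<forall>q\<in>Q. \<forall>a\<in>A. d q a \<in> Q" "L = {w \<in> lists A. foldl d i w \<in> F}"
    using assms unfolding regular_lang_def by blast
  \<comment> \<open>The Boolean component remembers whether an accepting state has been visited; the
    start must already record \<open>i \<in> F\<close> for the empty prefix.\<close>
  define e where "e = (\<lambda>(q, b) a. (d q a, b \<or> d q a \<in> F))"
  have run: "foldl e (i, i \<in> F) w = (foldl d i w, \<exists>n. foldl d i (take n w) \<in> F)" for w
  proof (induction w rule: rev_induct)
    case Nil
    then show ?case by simp
  next
    case (snoc a w)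
    have "(\<exists>n. foldl d i (take n (w @ [a])) \<in> F) \<longleftrightarrow>
        (\<exists>n. foldl d i (take n w) \<in> F) \<or> foldl d i (w @ [a]) \<in> F"
    proof (intro iffI)
      assume "\<exists>n. foldl d i (take n (w @ [a])) \<in> F"
      then obtain n where n: "foldl d i (take n (w @ [a])) \<in> F" by blast
      show "(\<exists>n. foldl d i (take n w) \<in> F) \<or> foldl d i (w @ [a]) \<in> F"
        by (cases "n \<le> length w") (use n in auto)
    next
      assume "(\<exists>n. foldl d i (take n w) \<in> F) \<or> foldl d i (w @ [a]) \<in> F"
      then show "\<exists>n. foldl d i (take n (w @ [a])) \<in> F"
      proof
        assume "\<exists>n. foldl d i (take n w) \<in> F"
        then obtain n where n: "foldl d i (take n w) \<in> F" by blast
        have "take (min n (length w)) (w @ [a]) = take n w" by (simp add: min_def)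
        with n show ?thesis by metis
      next
        assume "foldl d i (w @ [a]) \<in> F"
        then show ?thesis by (intro exI[of _ "Suc (length w)"]) simp
      qed
    qed
    then show ?case using snoc by (simp add: e_def)
  qed
  have "regular_lang A {w \<in> lists A. foldl e (i, i \<in> F) w \<in> Collect snd}"
    by (rule regular_langI[where Q = "Q \<times> UNIV" and i = "(i, i \<in> F)" and d = e, OF _ _ _ _ refl])
      (use 1 in \<open>auto simp: e_def\<close>)
  also have "{w \<in> lists A. foldl e (i, i \<in> F) w \<in> Collect snd} = {w \<in> lists A. \<exists>n. take n w \<in> L}"
    using 1(5) by (auto simp: run dest: in_set_takeD)
  finally show ?thesis .
qed

lemma regular_lang_empty: "finite A \<Longrightarrow> regular_lang A {}"
  by (rule regular_langI[of A "{()}" "()" "\<lambda>_ _. ()" _ "{}"]) auto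

lemma regular_lang_UN:
  assumes "finite A" "finite T" "\<And>t. t \<in> T \<Longrightarrow> regular_lang A (L t)" "\<And>t. t \<in> T \<Longrightarrow> L t \<subseteq> lists A"
  shows "regular_lang A (\<Union>t\<in>T. L t)"
  using assms(2-4)
proof (induction T)
  case empty
  then show ?case using assms(1) by (simp add: regular_lang_empty)
next
  case (insert t T)
  then have "(\<Union>t\<in>insert t T. L t) = {w \<in> lists A. w \<in> L t \<or> w \<in> (\<Union>t\<in>T. L t)}"
    by blast
  then show ?case
    using regular_lang_combine[of A "L t" "\<Union>t\<in>T. L t" "(\<or>)"] insert by simp
qed

text \<open>Myhill-Nerode principle: the finitely many values of \<open>S\<close> are the states,
  and \<open>step\<close> makes the next value depend only on the current value and the letter. It
  allows an automaton to be given by an invariant instead of a transition function.\<close>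

lemma regular_lang_invariant:
  assumes "finite A" "finite (S ` lists A)"
    and step: "\<And>u v a. u \<in> lists A \<Longrightarrow> v \<in> lists A \<Longrightarrow> a \<in> A \<Longrightarrow> S u = S v \<Longrightarrow> S (u @ [a]) = S (v @ [a])"
  shows "regular_lang A {w \<in> lists A. P (S w)}"
proof -
  define rep where "rep q = (SOME u. u \<in> lists A \<and> S u = q)" for q
  have rep: "rep (S u) \<in> lists A \<and> S (rep (S u)) = S u" if "u \<in> lists A" for u
    unfolding rep_def by (rule someI[of _ u]) (use that in simp)
  define d where "d q a = S (rep q @ [a])" for q a
  have d: "d (S u) a = S (u @ [a])" if "u \<in> lists A" "a \<in> A" for u a
    unfolding d_def using rep[OF that(1)] that by (intro step) auto
  have run: "foldl d (S []) w = S w" if "w \<in> lists A" for w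
    using that by (induction w rule: rev_induct) (auto simp: d)
  show ?thesis
  proof (rule regular_langI[where Q = "S ` lists A" and i = "S []" and d = d and F = "Collect P"])
    show "d q a \<in> S ` lists A" if q: "q \<in> S ` lists A" and a: "a \<in> A" for q a
    proof -
      obtain u where u: "q = S u" "u \<in> lists A" using q by blast
      then have "u @ [a] \<in> lists A" using a by simp
      then show ?thesis unfolding u(1) d[OF u(2) a] by (rule imageI)
    qed
    show "{w \<in> lists A. P (S w)} = {w \<in> lists A. foldl d (S []) w \<in> Collect P}"
      by (intro Collect_cong conj_cong refl) (simp only: run mem_Collect_eq)
    show "S [] \<in> S ` lists A" by (intro imageI) simp
  qed (use assms in auto)
qed

lemma regular_lang_finite:
  assumes "finite A" "finite L" "L \<subseteq> lists A"
  shows "regular_lang A L"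
proof -
  obtain n where n: "\<And>w. w \<in> L \<Longrightarrow> length w < n"
    using assms(2) by (metis finite_imageI finite_nat_set_iff_bounded imageI)
  have "take n ` lists A \<subseteq> {w. set w \<subseteq> A \<and> length w \<le> n}"
    by (auto dest: in_set_takeD)
  then have fin: "finite (take n ` lists A)"
    using finite_lists_length_le[OF assms(1)] finite_subset by blast
  \<comment> \<open>Remembering \<open>n\<close> letters suffices: \<open>n\<close> exceeds every
    length in \<open>L\<close>, so \<open>take n w \<in> L\<close> forces \<open>w\<close> itself to
    be shorter than \<open>n\<close>.\<close>
  have "regular_lang A {w \<in> lists A. take n w \<in> L}"
  proof (rule regular_lang_invariant[where S = "take n" and P = "\<lambda>v. v \<in> L"])
    fix u v a assume eq: "take n u = take n v"
    then have "min n (length u) = min n (length v)" by (metis length_take min.commute)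
    with eq show "take n (u @ [a]) = take n (v @ [a])"
      by (cases "n \<le> length u"; cases "n \<le> length v") auto
  qed (use assms fin in auto)
  moreover have "{w \<in> lists A. take n w \<in> L} = L"
  proof -
    have "take n w = w" if "take n w \<in> L" for w using n[OF that] by (simp add: min_def split: if_splits)
    moreover have "take n w = w" if "w \<in> L" for w using n[OF that] by simp
    ultimately have "take n w \<in> L \<longleftrightarrow> w \<in> L" for w by metis
    then show ?thesis using assms(3) by auto
  qed
  ultimately show ?thesis by simp
qed

section \<open>Rational power series\<close>

lemma rational_fps_poly: "rational_fps (fps_of_poly p)"
  unfolding rational_fps_def by (intro exI[of _ p] exI[of _ 1]) simp

lemma rational_fps_1: "rational_fps 1"
  using rational_fps_poly[of 1] by simp

lemma rational_fps_uminus: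
  assumes "rational_fps f"
  shows "rational_fps (- f)"
proof -
  obtain p q where "q \<noteq> 0" "f * fps_of_poly q = fps_of_poly p"
    using assms by (auto simp: rational_fps_def)
  then have "- f * fps_of_poly q = fps_of_poly (- p)"
    by (simp add: fps_of_poly_uminus)
  with \<open>q \<noteq> 0\<close> show ?thesis unfolding rational_fps_def by blast
qed

lemma rational_fps_0: "rational_fps 0"
  using rational_fps_poly[of 0] by simp

lemma rational_fps_add:
  assumes "rational_fps f" "rational_fps g"
  shows "rational_fps (f + g)"
proof -
  obtain p q p' q' where *: "q \<noteq> 0" "f * fps_of_poly q = fps_of_poly p"
    "q' \<noteq> 0" "g * fps_of_poly q' = fps_of_poly p'"
    using assms by (auto simp: rational_fps_def)
  have "(f + g) * fps_of_poly (q * q') =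
      (f * fps_of_poly q) * fps_of_poly q' + (g * fps_of_poly q') * fps_of_poly q"
    by (simp add: fps_of_poly_mult algebra_simps)
  also have "\<dots> = fps_of_poly (p * q' + p' * q)"
    by (simp add: * fps_of_poly_mult fps_of_poly_add)
  finally show ?thesis using *(1,3) unfolding rational_fps_def by (intro exI[of _ "q * q'"] exI conjI) auto
qed

lemma rational_fps_mult:
  assumes "rational_fps f" "rational_fps g"
  shows "rational_fps (f * g)"
proof -
  obtain p q p' q' where *: "q \<noteq> 0" "f * fps_of_poly q = fps_of_poly p"
    "q' \<noteq> 0" "g * fps_of_poly q' = fps_of_poly p'"
    using assms by (auto simp: rational_fps_def)
  have "(f * g) * fps_of_poly (q * q') = (f * fps_of_poly q) * (g * fps_of_poly q')"
    by (simp add: fps_of_poly_mult algebra_simps)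
  also have "\<dots> = fps_of_poly (p * p')"
    by (simp add: * fps_of_poly_mult)
  finally show ?thesis using *(1,3) unfolding rational_fps_def by (intro exI[of _ "q * q'"] exI conjI) auto
qed

lemma rational_fps_sum: "(\<And>x. x \<in> S \<Longrightarrow> rational_fps (f x)) \<Longrightarrow> rational_fps (sum f S)"
  by (induction S rule: infinite_finite_induct) (auto simp: rational_fps_0 rational_fps_add)

lemma rational_fps_inverse:
  assumes "rational_fps f" "fps_nth f 0 \<noteq> 0"
  shows "rational_fps (inverse f)"
proof -
  obtain p q where *: "q \<noteq> 0" "f * fps_of_poly q = fps_of_poly p"
    using assms by (auto simp: rational_fps_def)
  have "f \<noteq> 0" using assms(2) by auto
  then have "p \<noteq> 0" using * by auto
  moreover have "inverse f * fps_of_poly p = fps_of_poly q"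
    using inverse_mult_eq_1[OF assms(2)] by (simp flip: *(2) mult.assoc)
  ultimately show ?thesis by (auto simp: rational_fps_def)
qed

text \<open>Gaussian elimination: since the matrix vanishes at 0, every pivot is a unit.\<close>

lemma rational_fps_linear_system:
  fixes F :: "'q \<Rightarrow> 'k::field fps"
  assumes "finite Q"
    and "\<And>q. q \<in> Q \<Longrightarrow> F q = p q + (\<Sum>q'\<in>Q. M q q' * F q')"
    and "\<And>q. rational_fps (p q)" "\<And>q q'. rational_fps (M q q')" "\<And>q q'. fps_nth (M q q') 0 = 0"
  shows "\<forall>q\<in>Q. rational_fps (F q)"
  using assms
proof (induction Q arbitrary: p M)
  case empty
  then show ?case by simp
next
  case (insert x Q)
  \<comment> \<open>The inverse of the pivot: row \<open>x\<close> is solved for \<open>F x\<close>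
    and substituted into the other rows.\<close>
  define u where "u = inverse (1 - M x x)"
  have u: "u * (1 - M x x) = 1"
    unfolding u_def using insert.prems(4) by (intro inverse_mult_eq_1) simp
  have "rational_fps (1 + - M x x)"
    using insert.prems by (intro rational_fps_add rational_fps_uminus rational_fps_1)
  then have ru: "rational_fps u"
    unfolding u_def using insert.prems(4) by (intro rational_fps_inverse) auto
  have "F x = p x + M x x * F x + (\<Sum>q'\<in>Q. M x q' * F q')"
    using insert.prems(1)[of x] insert.hyps by (simp add: algebra_simps)
  then have "(1 - M x x) * F x = p x + (\<Sum>q'\<in>Q. M x q' * F q')"
    by (simp add: algebra_simps)
  then have Fx: "F x = u * (p x + (\<Sum>q'\<in>Q. M x q' * F q'))"
    using u by (metis mult.assoc mult_1)
  have "\<forall>q\<in>Q. rational_fps (F q)"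
  proof (rule insert.IH)
    fix q assume "q \<in> Q"
    then have "F q = p q + M q x * F x + (\<Sum>q'\<in>Q. M q q' * F q')"
      using insert.prems(1)[of q] insert.hyps by (simp add: algebra_simps)
    \<comment> \<open>Each term of a new entry contains an entry of \<open>M\<close>, so the new
      matrix again vanishes at 0, as the induction hypothesis demands.\<close>
    also have "\<dots> = (p q + M q x * u * p x) + (\<Sum>q'\<in>Q. (M q q' + M q x * u * M x q') * F q')"
      by (subst Fx) (simp add: algebra_simps sum.distrib sum_distrib_left)
    finally show "F q = (p q + M q x * u * p x) + (\<Sum>q'\<in>Q. (M q q' + M q x * u * M x q') * F q')" .
  qed (use ru insert.prems in \<open>auto intro!: rational_fps_add rational_fps_mult\<close>)
  moreover have "rational_fps (F x)"
    unfolding Fx using calculation ru insert.prems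
    by (intro rational_fps_mult rational_fps_add rational_fps_sum) auto
  ultimately show ?case by simp
qed

text \<open>Transfer matrix method: splitting off the first letter gives a linear system for the
  series \<open>f q\<close> that count the words accepted from \<open>q\<close>. The letter
  contributes a factor \<open>fps_X\<close>, so the matrix vanishes at 0.\<close>

lemma regular_lang_rational_growth:
  assumes "regular_lang A L"
  shows "rational_fps (Abs_fps (\<lambda>n. of_nat (card {w \<in> L. length w = n})) :: 'k::field fps)"
proof -
  obtain Q :: "nat set" and i d F where 1: "finite A" "finite Q" "i \<in> Q"
    "\<forall>q\<in>Q. \<forall>a\<in>A. d q a \<in> Q" "L = {w \<in> lists A. foldl d i w \<in> F}"
    using assms unfolding regular_lang_def by blast
  define W where "W q n = {w \<in> lists A. foldl d q w \<in> F \<and> length w = n}" for q n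
  define f :: "nat \<Rightarrow> 'k fps" where "f q = Abs_fps (\<lambda>n. of_nat (card (W q n)))" for q
  have finW: "finite (W q n)" for q n
    by (rule finite_subset[OF _ finite_lists_length_eq[OF 1(1), of n]]) (auto simp: W_def)
  have W0: "W q 0 = (if q \<in> F then {[]} else {})" for q
    by (auto simp: W_def)
  have WSuc: "card (W q (Suc n)) = (\<Sum>a\<in>A. card (W (d q a) n))" for q n
  proof -
    have "W q (Suc n) = (\<Union>a\<in>A. (\<lambda>w. a # w) ` W (d q a) n)"
    proof (rule Set.set_eqI, rule iffI)
      fix w assume "w \<in> W q (Suc n)"
      then show "w \<in> (\<Union>a\<in>A. (\<lambda>w. a # w) ` W (d q a) n)"
        by (cases w) (auto simp: W_def)
    qed (auto simp: W_def)
    also have "card \<dots> = (\<Sum>a\<in>A. card ((\<lambda>w. a # w) ` W (d q a) n))"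
      using 1(1) finW by (intro card_UN_disjoint) auto
    also have "\<dots> = (\<Sum>a\<in>A. card (W (d q a) n))"
      by (intro sum.cong card_image) (auto simp: inj_on_def)
    finally show ?thesis .
  qed
  define p :: "nat \<Rightarrow> 'k fps" where "p q = fps_of_poly (if q \<in> F then 1 else 0)" for q
  define M :: "nat \<Rightarrow> nat \<Rightarrow> 'k fps"
    where "M q q' = fps_X * (\<Sum>a\<in>A. if d q a = q' then 1 else 0)" for q q'
  have "\<forall>q\<in>Q. rational_fps (f q)"
  proof (rule rational_fps_linear_system[OF 1(2)])
    fix q assume q: "q \<in> Q"
    have "(\<Sum>q'\<in>Q. M q q' * f q') = fps_X * (\<Sum>q'\<in>Q. \<Sum>a\<in>A. if d q a = q' then f q' else 0)"
      by (simp add: M_def sum_distrib_left sum_distrib_right mult.assoc if_distrib[of "\<lambda>x. x * _"] cong: if_cong)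
    also have "\<dots> = fps_X * (\<Sum>a\<in>A. \<Sum>q'\<in>Q. if d q a = q' then f q' else 0)"
      by (subst sum.swap) simp
    also have "\<dots> = fps_X * (\<Sum>a\<in>A. f (d q a))"
      using q 1 by (simp add: sum.delta')
    finally have eq: "(\<Sum>q'\<in>Q. M q q' * f q') = fps_X * (\<Sum>a\<in>A. f (d q a))" .
    show "f q = p q + (\<Sum>q'\<in>Q. M q q' * f q')"
    proof (rule fps_ext)
      fix n show "fps_nth (f q) n = fps_nth (p q + (\<Sum>q'\<in>Q. M q q' * f q')) n"
        unfolding eq by (cases n) (auto simp: f_def p_def W0 WSuc fps_sum_nth)
    qed
  next
    fix q q'
    have "rational_fps (fps_X :: 'k fps)" using rational_fps_poly[of "[:0,1:] :: 'k poly"]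
      by (simp add: fps_of_poly_fps_X)
    then show "rational_fps (M q q')"
      unfolding M_def by (intro rational_fps_mult rational_fps_sum) (auto simp: rational_fps_0 rational_fps_1)
  qed (auto simp: p_def M_def rational_fps_poly)
  moreover have "{w \<in> L. length w = n} = W i n" for n
    by (auto simp: W_def 1(5))
  ultimately show ?thesis using 1(3) by (auto simp: f_def)
qed

lemma lenlex_snoc_iff:
  assumes "length v = length u"
  shows "(v @ [b], u @ [a]) \<in> lenlex R \<longleftrightarrow> (v, u) \<in> lenlex R \<or> v = u \<and> (b, a) \<in> R"
  using assms by (induction v u rule: list_induct2) (auto simp: Cons_lenlex_iff)

section \<open>Virtually cyclic groups\<close>

context group
begin

lemma mult_inv_mult_cancel:
  assumes "a \<in> carrier G" "b \<in> carrier G"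
  shows "a \<otimes> (inv a \<otimes> b) = b" "inv a \<otimes> (a \<otimes> b) = b"
  using assms by (simp_all flip: m_assoc)

lemma int_pow_conj:
  assumes "g \<in> carrier G" "x \<in> carrier G"
  shows "inv g \<otimes> x [^] (n::int) \<otimes> g = (inv g \<otimes> x \<otimes> g) [^] n"
proof -
  have "(\<lambda>x. inv g \<otimes> x \<otimes> g) \<in> hom G G"
    using assms(1) by (intro homI) (simp_all add: m_assoc mult_inv_mult_cancel)
  then interpret group_hom G G "\<lambda>x. inv g \<otimes> x \<otimes> g"
    by unfold_locales
  show ?thesis using hom_int_pow[OF assms(2)] by simp
qed

lemma virtually_cyclic_cosets:
  assumes "virtually_cyclic G"
  obtains h T where "h \<in> carrier G" "finite T" "T \<subseteq> carrier G"
    "\<And>g. g \<in> carrier G \<Longrightarrow> \<exists>n::int. \<exists>t\<in>T. g = h [^] n \<otimes> t"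
proof -
  obtain H where H: "subgroup H G" "cyclic_group (G\<lparr>carrier := H\<rparr>)" "finite (rcosets H)"
    using assms by (auto simp: virtually_cyclic_def)
  interpret H: group "G\<lparr>carrier := H\<rparr>"
    using subgroup_imp_group[OF H(1)] .
  obtain h where h: "h \<in> H" "H = range (\<lambda>n::int. h [^]\<^bsub>G\<lparr>carrier := H\<rparr>\<^esub> n)"
    using H(2) unfolding H.cyclic_group by auto
  then have Hr: "H = range (\<lambda>n::int. h [^] n)"
    using int_pow_consistent[OF H(1) h(1)] by simp
  have "h \<in> carrier G" using h(1) subgroup.subset[OF H(1)] by auto
  moreover define T where "T = (\<lambda>R. SOME t. t \<in> R) ` (rcosets H)"
  have some: "(SOME t. t \<in> R) \<in> R" if "R \<in> rcosets H" for R
    using subgroup.rcosets_non_empty[OF H(1) that] by (simp add: some_in_eq)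
  have "finite T" using H(3) by (simp add: T_def)
  moreover have "T \<subseteq> carrier G"
    using some rcosets_part_G[OF H(1)] by (auto simp: T_def)
  moreover have "\<exists>n::int. \<exists>t\<in>T. g = h [^] n \<otimes> t" if g: "g \<in> carrier G" for g
  proof -
    have R: "H #> g \<in> rcosets H"
      using rcosetsI[OF subgroup.subset[OF H(1)] g] .
    define t where "t = (SOME t. t \<in> H #> g)"
    have t: "t \<in> T" "t \<in> H #> g" using some[OF R] R by (auto simp: t_def T_def)
    then obtain n :: int where "t = h [^] n \<otimes> g" by (auto simp: r_coset_def Hr)
    then have "g = h [^] (- n) \<otimes> t"
      using g \<open>h \<in> carrier G\<close> by (simp add: int_pow_neg mult_inv_mult_cancel)
    with t(1) show ?thesis by blast
  qed
  ultimately show ?thesis using that by blast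
qed

text \<open>Pigeonhole on the \<open>card T + 1\<close> elements
  \<open>inv g \<otimes> u [^] i\<close>: two share a representative in \<open>T\<close>, and their
  quotient is both a conjugate of a power of \<open>u\<close> and a power of \<open>h\<close>. The
  bound on \<open>k\<close> does not depend on \<open>g\<close>, so one factorial can serve all
  \<open>g\<close>.\<close>

lemma conj_int_pow_in_cyclic:
  assumes h: "h \<in> carrier G" and g: "g \<in> carrier G"
    and T: "finite T" "T \<subseteq> carrier G"
    and dec: "\<And>g. g \<in> carrier G \<Longrightarrow> \<exists>n::int. \<exists>t\<in>T. g = h [^] n \<otimes> t"
    and u: "u \<in> carrier G"
  obtains k :: nat and m :: int where "0 < k" "k \<le> card T" "inv g \<otimes> u [^] k \<otimes> g = h [^] m"
proof -
  define f where "f i = (SOME t. t \<in> T \<and> (\<exists>n::int. inv g \<otimes> u [^] (i::nat) = h [^] n \<otimes> t))" for i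
  have f: "f i \<in> T \<and> (\<exists>n::int. inv g \<otimes> u [^] i = h [^] n \<otimes> f i)" for i
    unfolding f_def by (rule someI_ex) (use dec[of "inv g \<otimes> u [^] i"] g u in auto)
  have "card (f ` {..card T}) < card {..card T}"
    using card_mono[OF T(1) image_subsetI, of "{..card T}" f] f by (simp add: less_Suc_eq_le)
  then have "\<not> inj_on f {..card T}" by (rule pigeonhole)
  then obtain i j where ij: "i < j" "j \<le> card T" "f i = f j"
    unfolding inj_on_def by (metis atMost_iff linorder_neqE_nat)
  obtain m n :: int where mn: "inv g \<otimes> u [^] i = h [^] m \<otimes> f i" "inv g \<otimes> u [^] j = h [^] n \<otimes> f j"
    using f by metis
  have tc: "f i \<in> carrier G" using f T(2) by auto
  have "u [^] (j - i) = u [^] j \<otimes> inv (u [^] i)"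
    using ij(1) u by (metis add_diff_inverse_nat inv_solve_right less_imp_not_less nat_pow_closed nat_pow_mult add.commute)
  then have "inv g \<otimes> u [^] (j - i) \<otimes> g = (inv g \<otimes> u [^] j) \<otimes> inv (inv g \<otimes> u [^] i)"
    using g u by (simp add: inv_mult_group m_assoc)
  also have "\<dots> = h [^] n \<otimes> inv (h [^] m)"
    using h tc ij(3) by (simp add: mn inv_mult_group m_assoc mult_inv_mult_cancel)
  also have "\<dots> = h [^] (n - m)" using h by (simp add: int_pow_diff)
  finally show ?thesis using that[of "j - i" "n - m"] ij by simp
qed

text \<open>For \<open>M = (card T)!\<close>, conjugation by \<open>g\<close> maps \<open>h\<^sup>M\<close> to some \<open>h\<^sup>a\<close>. A power \<open>g\<^sup>p\<close> lies in the
  cyclic subgroup, hence commutes with \<open>h\<close>, which forces \<open>a\<^sup>p = M\<^sup>p\<close> and so \<open>a = \<plusminus>M\<close>.\<close>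

lemma conj_fact_power:
  assumes h: "h \<in> carrier G" and g: "g \<in> carrier G"
    and T: "finite T" "T \<subseteq> carrier G"
    and dec: "\<And>g. g \<in> carrier G \<Longrightarrow> \<exists>n::int. \<exists>t\<in>T. g = h [^] n \<otimes> t"
    and inj: "inj (\<lambda>n::int. h [^] n)"
    and z: "z = h [^] int (fact (card T))"
  shows "inv g \<otimes> z \<otimes> g \<in> {z, inv z}"
proof -
  define M where "M = int (fact (card T))"
  have "\<exists>a::int. inv g \<otimes> h [^] M \<otimes> g = h [^] a"
  proof -
    obtain k :: nat and m :: int where k: "0 < k" "k \<le> card T" "inv g \<otimes> h [^] k \<otimes> g = h [^] m"
      by (rule conj_int_pow_in_cyclic[OF h g T dec h])
    \<comment> \<open>\<open>k\<close> varies with \<open>g\<close>, but being positive and at most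
      \<open>card T\<close> it always divides the factorial.\<close>
    then have "k dvd fact (card T)" by (intro dvd_fact) auto
    then obtain c where c: "fact (card T) = k * c" by (auto simp: dvd_def)
    have "inv g \<otimes> h [^] M \<otimes> g = inv g \<otimes> (h [^] int k) [^] int c \<otimes> g"
      using h by (simp add: M_def c int_pow_pow)
    also have "\<dots> = (inv g \<otimes> h [^] int k \<otimes> g) [^] int c"
      using h g by (intro int_pow_conj) auto
    also have "\<dots> = h [^] (m * int c)"
      using k(3) int_pow_pow[OF h, of m "int c"] by (simp only: int_pow_int)
    finally show ?thesis by blast
  qed
  then obtain a :: int where a: "inv g \<otimes> h [^] M \<otimes> g = h [^] a" by blast
  have conj: "inv g \<otimes> h [^] (M * n) \<otimes> g = h [^] (a * n)" for n
    using int_pow_conj[OF g, of "h [^] M" n] h a by (simp add: int_pow_pow)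
  \<comment> \<open>Each conjugation by \<open>g\<close> exchanges one factor \<open>M\<close> of
    the exponent for \<open>a\<close>; hence the start at \<open>M ^ p\<close>.\<close>
  have iter: "inv (g [^] p) \<otimes> h [^] (M ^ p) \<otimes> g [^] p = h [^] (a ^ p)" for p :: nat
  proof (induction p)
    case 0
    then show ?case using h by simp
  next
    case (Suc p)
    have "inv (g [^] Suc p) \<otimes> h [^] (M ^ Suc p) \<otimes> g [^] Suc p =
        inv g \<otimes> (inv (g [^] p) \<otimes> (h [^] (M ^ p)) [^] M \<otimes> g [^] p) \<otimes> g"
      using h g by (simp add: inv_mult_group m_assoc int_pow_pow mult.commute)
    also have "\<dots> = inv g \<otimes> (h [^] (a ^ p)) [^] M \<otimes> g"
      using h g by (subst int_pow_conj) (auto simp: Suc)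
    also have "\<dots> = h [^] (a ^ Suc p)"
      using conj[of "a ^ p"] h by (simp add: int_pow_pow mult.commute)
    finally show ?case .
  qed
  \<comment> \<open>With conjugator \<open>\<one>\<close>, the pigeonhole argument puts a positive
    power of \<open>g\<close> into the cyclic subgroup.\<close>
  obtain p :: nat and m :: int where p: "0 < p" "inv \<one> \<otimes> g [^] p \<otimes> \<one> = h [^] m"
    by (rule conj_int_pow_in_cyclic[OF h one_closed T dec g])
  then have gp: "g [^] p = h [^] m" using g by simp
  have "h [^] (a ^ p) = h [^] (- m) \<otimes> h [^] (M ^ p) \<otimes> h [^] m"
    using iter[of p] h by (simp add: gp int_pow_neg)
  also have "\<dots> = h [^] (M ^ p)" using h by (simp flip: int_pow_mult)
  finally have "a ^ p = M ^ p" using inj by (auto dest: injD)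
  \<comment> \<open>An even \<open>p\<close> loses the sign of \<open>a\<close>, so only absolute
    values can be compared.\<close>
  then have "\<bar>a\<bar> ^ p = \<bar>M\<bar> ^ p" by (simp flip: power_abs)
  then have "\<bar>a\<bar> = \<bar>M\<bar>" using p(1) by (simp add: power_eq_iff_eq_base)
  then have "a = M \<or> a = - M" by linarith
  then show ?thesis using a h by (auto simp: z M_def int_pow_neg)
qed

text \<open>For an infinite group, \<open>z\<close> is the factorial power of \<open>h\<close> that
  every conjugation fixes or inverts. For a finite group, \<open>z = \<one>\<close> and
  \<open>T = carrier G\<close> meet the same conditions, so only the last disjunction separates the
  two cases.\<close>

lemma virtually_cyclic_structure:
  assumes "virtually_cyclic G"
  obtains z T where "z \<in> carrier G" "finite T" "T \<subseteq> carrier G"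
    "\<And>g. g \<in> carrier G \<Longrightarrow> \<exists>n::int. \<exists>t\<in>T. g = z [^] n \<otimes> t"
    "\<And>g. g \<in> carrier G \<Longrightarrow> inv g \<otimes> z \<otimes> g \<in> {z, inv z}"
    "finite (carrier G) \<or> inj (\<lambda>n::int. z [^] n)"
proof (cases "finite (carrier G)")
  case True
  have "\<exists>n::int. \<exists>t\<in>carrier G. g = \<one> [^] n \<otimes> t" if "g \<in> carrier G" for g
    using that by (intro exI[of _ 0] bexI[of _ g]) auto
  then show ?thesis using True by (intro that[of \<one> "carrier G"]) auto
next
  case False
  obtain h T where h: "h \<in> carrier G" and T: "finite T" "T \<subseteq> carrier G"
    and dec: "\<And>g. g \<in> carrier G \<Longrightarrow> \<exists>n::int. \<exists>t\<in>T. g = h [^] n \<otimes> t"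
    using virtually_cyclic_cosets[OF assms] by metis
  \<comment> \<open>If two powers of \<open>h\<close> agreed, exponents could be reduced modulo a
    positive period, making the group finite.\<close>
  have inj: "inj (\<lambda>n::int. h [^] n)"
  proof (rule ccontr)
    assume "\<not> inj (\<lambda>n::int. h [^] n)"
    then obtain i j :: int where ij: "i < j" "h [^] i = h [^] j"
      unfolding inj_def by (metis linorder_neqE_linordered_idom)
    define k where "k = j - i"
    have k: "k > 0" "h [^] k = \<one>" using ij h by (auto simp: k_def int_pow_diff)
    have red: "h [^] n = h [^] (n mod k)" for n :: int
    proof -
      have "h [^] n = h [^] (k * (n div k) + n mod k)" by simp
      also have "\<dots> = (h [^] k) [^] (n div k) \<otimes> h [^] (n mod k)"
        using h by (simp only: int_pow_mult int_pow_pow)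
      also have "\<dots> = h [^] (n mod k)" using h by (simp add: k(2))
      finally show ?thesis .
    qed
    have "carrier G \<subseteq> (\<lambda>(n::int, t). h [^] n \<otimes> t) ` ({0..<k} \<times> T)"
    proof (intro subsetI)
      fix g assume "g \<in> carrier G"
      then obtain n :: int and t where nt: "t \<in> T" "g = h [^] n \<otimes> t" using dec by blast
      show "g \<in> (\<lambda>(n::int, t). h [^] n \<otimes> t) ` ({0..<k} \<times> T)"
      proof (rule image_eqI[of _ _ "(n mod k, t)"])
        show "g = (case (n mod k, t) of (n, t) \<Rightarrow> h [^] n \<otimes> t)"
          unfolding nt(2) prod.case by (simp only: red[of n])
      qed (use nt(1) k(1) in auto)
    qed
    then show False using False T(1) finite_subset by blast
  qed
  define M where "M = int (fact (card T))"
  define z where "z = h [^] M"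
  \<comment> \<open>Dividing an exponent of \<open>h\<close> by \<open>M\<close> leaves a remainder
    in \<open>{0..<M}\<close>, which moves into the representative.\<close>
  define T' where "T' = (\<lambda>(i::int, t). h [^] i \<otimes> t) ` ({0..<M} \<times> T)"
  have M: "M > 0" by (simp add: M_def)
  have z: "z \<in> carrier G" using h by (simp add: z_def)
  show ?thesis
  proof (rule that)
    show "z \<in> carrier G" by fact
    show "finite T'" using T(1) by (simp add: T'_def)
    show "T' \<subseteq> carrier G" using T(2) h by (auto simp: T'_def)
    show "inv g \<otimes> z \<otimes> g \<in> {z, inv z}" if "g \<in> carrier G" for g
      by (rule conj_fact_power[OF h that T dec inj]) (simp_all add: z_def M_def)
    have "inj (\<lambda>n::int. h [^] (M * n))"
      using M inj by (intro injI) (metis injD mult_cancel_left less_irrefl)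
    then show "finite (carrier G) \<or> inj (\<lambda>n::int. z [^] n)"
      using h by (simp add: z_def int_pow_pow)
    show "\<exists>n::int. \<exists>t\<in>T'. g = z [^] n \<otimes> t" if g: "g \<in> carrier G" for g
    proof -
      obtain n :: int and t where nt: "t \<in> T" "g = h [^] n \<otimes> t" using dec[OF g] by blast
      have "h [^] n = h [^] (M * (n div M) + n mod M)" by simp
      also have "\<dots> = z [^] (n div M) \<otimes> h [^] (n mod M)"
        using h unfolding z_def by (simp only: int_pow_mult int_pow_pow)
      finally have "g = z [^] (n div M) \<otimes> (h [^] (n mod M) \<otimes> t)"
        using nt h T(2) z by (auto simp: m_assoc)
      moreover have "h [^] (n mod M) \<otimes> t \<in> T'"
        using nt(1) M by (auto simp: T'_def image_iff intro!: bexI[of _ "(n mod M, t)"])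
      ultimately show ?thesis by blast
    qed
  qed
qed

end

section \<open>Geodesics\<close>

lemma discrete_intermediate_value:
  fixes f :: "nat \<Rightarrow> int"
  assumes "i \<le> j" "0 \<le> K" "\<And>k. \<bar>f (Suc k) - f k\<bar> \<le> K"
    and "f i \<le> c \<and> c \<le> f j \<or> f j \<le> c \<and> c \<le> f i"
  shows "\<exists>k. i \<le> k \<and> k \<le> j \<and> \<bar>f k - c\<bar> \<le> K"
  using assms(1,4)
proof (induction j rule: dec_induct)
  case base
  then show ?case using assms(2) by (intro exI[of _ i]) auto
next
  case (step j)
  show ?case
  proof (cases "f i \<le> c \<and> c \<le> f j \<or> f j \<le> c \<and> c \<le> f i")
    case True
    then show ?thesis using step.IH le_SucI by blast
  next
    case False
    \<comment> \<open>Here \<open>c\<close> separates \<open>f j\<close> from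
      \<open>f (Suc j)\<close>, so the last step crosses it.\<close>
    then have "\<bar>f (Suc j) - c\<bar> \<le> K" using step.prems assms(3)[of j] by linarith
    then show ?thesis using step.hyps by (intro exI[of _ "Suc j"]) auto
  qed
qed

locale generated_group = group G for G (structure) +
  fixes X
  assumes finite_gens: "finite X" and inverse_closed: "inverse_closed_gens G X"
begin

abbreviation "val \<equiv> word_value G"

lemma gens_closed: "x \<in> X \<Longrightarrow> x \<in> carrier G" and gens_inv: "x \<in> X \<Longrightarrow> inv x \<in> X"
  using inverse_closed by (auto simp: inverse_closed_gens_def)

lemma val_Nil [simp]: "val [] = \<one>" and val_Cons [simp]: "val (x # w) = x \<otimes> val w"
  by (simp_all add: word_value_def)

lemma val_closed [simp]: "w \<in> lists X \<Longrightarrow> val w \<in> carrier G"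
  by (induction w) (auto simp: gens_closed)

lemma val_append [simp]: "v \<in> lists X \<Longrightarrow> w \<in> lists X \<Longrightarrow> val (v @ w) = val v \<otimes> val w"
  by (induction v) (auto simp: gens_closed m_assoc)

lemma take_lists [simp]: "w \<in> lists A \<Longrightarrow> take n w \<in> lists A"
  and drop_lists [simp]: "w \<in> lists A \<Longrightarrow> drop n w \<in> lists A"
  by (auto dest: in_set_takeD in_set_dropD)

lemma ex_word: "g \<in> carrier G \<Longrightarrow> \<exists>w\<in>lists X. val w = g"
  using word_value_surj[OF is_group inverse_closed] .

section \<open>Balls, distance and geodesics in the word metric\<close>

definition ball :: "nat \<Rightarrow> 'a set" where
  "ball n = val ` {w \<in> lists X. length w \<le> n}"

lemma ballI: "w \<in> lists X \<Longrightarrow> length w \<le> n \<Longrightarrow> val w \<in> ball n"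
  unfolding ball_def by simp

lemma ballE:
  assumes "g \<in> ball n"
  obtains w where "w \<in> lists X" "length w \<le> n" "val w = g"
  using assms unfolding ball_def by blast

lemma ball_closed: "ball n \<subseteq> carrier G"
  unfolding ball_def using val_closed by blast

lemma finite_ball: "finite (ball n)"
proof -
  have "{w \<in> lists X. length w \<le> n} = {w. set w \<subseteq> X \<and> length w \<le> n}" by auto
  then show ?thesis
    using finite_lists_length_le[OF finite_gens, of n] by (simp add: ball_def)
qed

lemma ball_mono: "m \<le> n \<Longrightarrow> ball m \<subseteq> ball n"
  by (auto simp: ball_def)

lemma ball_mult:
  assumes "g \<in> ball m" "h \<in> ball n"
  shows "g \<otimes> h \<in> ball (m + n)"
proof -
  obtain v w where "v \<in> lists X" "length v \<le> m" "val v = g" "w \<in> lists X" "length w \<le> n" "val w = h"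
    using assms by (auto simp: ball_def simp del: in_lists_conv_set)
  then show ?thesis
    unfolding ball_def by (intro image_eqI[of _ _ "v @ w"]) (auto simp del: in_lists_conv_set)
qed

lemma ball_inv:
  assumes "g \<in> ball n"
  shows "inv g \<in> ball n"
proof -
  have "\<exists>v\<in>lists X. length v = length w \<and> val v = inv (val w)" if "w \<in> lists X" for w
    using that
  proof (induction w)
    case Nil
    then show ?case by simp
  next
    case (Cons x w)
    then obtain v where "v \<in> lists X" "length v = length w" "val v = inv (val w)" by auto
    then show ?case
      using Cons.hyps gens_closed gens_inv
      by (intro bexI[of _ "v @ [inv x]"])
        (auto simp: inv_mult_group simp del: in_lists_conv_set)
  qed
  moreover obtain w where "w \<in> lists X" "length w \<le> n" "val w = g"
    using assms by (rule ballE)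
  ultimately obtain v where "v \<in> lists X" "length v \<le> n" "val v = inv g" by metis
  then show ?thesis using ballI by metis
qed

lemma finite_subset_ball:
  assumes "finite S" "S \<subseteq> carrier G"
  shows "\<exists>n. S \<subseteq> ball n"
  using assms
proof (induction S)
  case empty
  then show ?case by simp
next
  case (insert g S)
  then obtain n where n: "S \<subseteq> ball n" by auto
  obtain w where "w \<in> lists X" "val w = g" using ex_word insert.prems by blast
  then have "g \<in> ball (length w)" by (auto simp: ball_def simp del: in_lists_conv_set)
  then have "insert g S \<subseteq> ball (max n (length w))"
    using n ball_mono[of n "max n (length w)"] ball_mono[of "length w" "max n (length w)"] by auto
  then show ?case ..
qed

text \<open>The word metric as a relation, distance at most \<open>n\<close>. Measuring
  \<open>inv g \<otimes> h\<close> makes it invariant under left multiplication.\<close>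

definition near :: "nat \<Rightarrow> 'a \<Rightarrow> 'a \<Rightarrow> bool" where
  "near n g h \<longleftrightarrow> g \<in> carrier G \<and> h \<in> carrier G \<and> inv g \<otimes> h \<in> ball n"

lemma near_refl: "g \<in> carrier G \<Longrightarrow> near 0 g g"
  by (auto simp: near_def ball_def)

lemma near_sym:
  assumes "near n g h"
  shows "near n h g"
  using assms ball_inv[of "inv g \<otimes> h" n] by (simp add: near_def inv_mult_group)

lemma near_mono: "near m g h \<Longrightarrow> m \<le> n \<Longrightarrow> near n g h"
  using ball_mono by (auto simp: near_def)

lemma near_trans:
  assumes "near m g h" "near n h k"
  shows "near (m + n) g k"
  using assms ball_mult[of "inv g \<otimes> h" m "inv h \<otimes> k" n]
  by (simp add: near_def m_assoc mult_inv_mult_cancel)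

lemma near_mult_left:
  assumes "g \<in> carrier G" "near n h k"
  shows "near n (g \<otimes> h) (g \<otimes> k)"
  using assms by (simp add: near_def inv_mult_group m_assoc mult_inv_mult_cancel)

text \<open>Steps are bounded at all times but minimality is required only up to \<open>N\<close>,
  so a path may stand still after its end. Paths of different lengths can then be compared at equal
  times.\<close>

definition geodesic_path :: "(nat \<Rightarrow> 'a) \<Rightarrow> nat \<Rightarrow> bool" where
  "geodesic_path \<gamma> N \<longleftrightarrow> (\<forall>i. near 1 (\<gamma> i) (\<gamma> (Suc i))) \<and>
     (\<forall>i j n. i \<le> j \<longrightarrow> j \<le> N \<longrightarrow> near n (\<gamma> i) (\<gamma> j) \<longrightarrow> j \<le> i + n)"

lemma geodesic_path_near:
  assumes "geodesic_path \<gamma> N" "i \<le> j"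
  shows "near (j - i) (\<gamma> i) (\<gamma> j)"
  using assms(2)
proof (induction j rule: dec_induct)
  case base
  have "\<gamma> i \<in> carrier G" using assms(1) by (auto simp: geodesic_path_def near_def)
  then show ?case by (simp add: near_refl)
next
  case (step j)
  have "near 1 (\<gamma> j) (\<gamma> (Suc j))" using assms(1) by (auto simp: geodesic_path_def)
  from near_trans[OF step.IH this] show ?case
    using step.hyps by (simp add: Suc_diff_le)
qed

lemma geodesic_path_length:
  assumes "geodesic_path \<gamma> N" "i \<le> j" "j \<le> N" "near n (\<gamma> i) (\<gamma> j)"
  shows "j \<le> i + n"
  using assms by (auto simp: geodesic_path_def)

definition geodesic_word :: "'a list \<Rightarrow> bool" where
  "geodesic_word w \<longleftrightarrow> w \<in> lists X \<and> (\<forall>v\<in>lists X. val v = val w \<longrightarrow> length w \<le> length v)"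

text \<open>A shortcut between two points of the path would shorten \<open>w\<close>, and left
  translation preserves distances. The free start \<open>g\<close> is there for paths that begin at
  a conjugator.\<close>

lemma geodesic_word_path:
  assumes "geodesic_word w" "g \<in> carrier G"
  shows "geodesic_path (\<lambda>i. g \<otimes> val (take i w)) (length w)"
proof -
  have w: "w \<in> lists X" using assms(1) by (simp add: geodesic_word_def)
  have "near 1 (g \<otimes> val (take i w)) (g \<otimes> val (take (Suc i) w))" for i
  proof (intro near_mult_left assms(2))
    show "near 1 (val (take i w)) (val (take (Suc i) w))"
    proof (cases "i < length w")
      case True
      have wi: "w ! i \<in> X" using w True by auto
      then have "[w ! i] \<in> {w \<in> lists X. length w \<le> 1}" by simp
      then have "val [w ! i] \<in> ball 1" unfolding ball_def by (rule imageI)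
      moreover have "val (take (Suc i) w) = val (take i w) \<otimes> w ! i"
        using True w wi gens_closed
        by (simp add: take_Suc_conv_app_nth del: in_lists_conv_set)
      ultimately show ?thesis
        using w wi gens_closed
        by (simp add: near_def mult_inv_mult_cancel del: in_lists_conv_set)
    next
      case False
      then show ?thesis using near_mono[OF near_refl, of "val w" 1] w by simp
    qed
  qed
  moreover have "j \<le> i + n"
    if ij: "i \<le> j" "j \<le> length w" and near: "near n (g \<otimes> val (take i w)) (g \<otimes> val (take j w))" for i j n
  proof -
    have "near n (val (take i w)) (val (take j w))"
      using near_mult_left[OF inv_closed[OF assms(2)] near] assms(2) w
      by (simp add: mult_inv_mult_cancel del: in_lists_conv_set)
    then obtain v where v: "v \<in> lists X" "length v \<le> n" "val v = inv (val (take i w)) \<otimes> val (take j w)"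
      unfolding near_def using ballE by metis
    have "val (take i w @ v @ drop j w) = val (take j w) \<otimes> val (drop j w)"
      using w v by (simp add: m_assoc mult_inv_mult_cancel del: in_lists_conv_set)
    also have "\<dots> = val w" using w by (simp flip: val_append del: in_lists_conv_set)
    finally have "length w \<le> length (take i w @ v @ drop j w)"
      using assms(1) v w unfolding geodesic_word_def
      by (metis append_in_lists_conv drop_lists take_lists)
    then show ?thesis using ij v by simp
  qed
  ultimately show ?thesis by (auto simp: geodesic_path_def)
qed

text \<open>The cyclic subgroup gives a quasi-isometry to the integers: read off the exponent of \<open>z\<close>.\<close>

lemma quasi_isometry_to_int:
  assumes z: "z \<in> carrier G" and T: "finite T" "T \<subseteq> carrier G"
    and dec: "\<And>g. g \<in> carrier G \<Longrightarrow> \<exists>n::int. \<exists>t\<in>T. g = z [^] n \<otimes> t"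
    and inj: "finite (carrier G) \<or> inj (\<lambda>n::int. z [^] n)"
  obtains \<phi> :: "'a \<Rightarrow> int"
  where "\<And>r. \<exists>K\<ge>0. \<forall>g h. near r g h \<longrightarrow> \<bar>\<phi> g - \<phi> h\<bar> \<le> K"
    and "\<And>K. \<exists>r. \<forall>g\<in>carrier G. \<forall>h\<in>carrier G. \<bar>\<phi> g - \<phi> h\<bar> \<le> K \<longrightarrow> near r g h"
proof (cases "finite (carrier G)")
  case True
  \<comment> \<open>In a finite group all distances are bounded, so a constant map works.\<close>
  then obtain r where "carrier G \<subseteq> ball r" using finite_subset_ball[of "carrier G"] by auto
  then have "near r g h" if "g \<in> carrier G" "h \<in> carrier G" for g h
    using that by (auto simp: near_def)
  then show ?thesis by (intro that[of "\<lambda>_. 0"]) auto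
next
  case False
  with inj have inj: "inj (\<lambda>n::int. z [^] n)" by simp
  define \<phi> where "\<phi> g = (SOME n::int. \<exists>t\<in>T. g = z [^] n \<otimes> t)" for g
  have \<phi>: "\<exists>t\<in>T. g = z [^] \<phi> g \<otimes> t" if "g \<in> carrier G" for g
    unfolding \<phi>_def by (rule someI_ex[OF dec[OF that]])
  show ?thesis
  proof (rule that)
    fix r
    \<comment> \<open>\<open>S\<close> contains \<open>z [^] n\<close> for every difference
      \<open>n\<close> of exponents at distance \<open>r\<close>; injectivity turns its finiteness
      into a bound on \<open>n\<close>.\<close>
    define S where "S = (\<lambda>(t, b, t'). t \<otimes> b \<otimes> inv t') ` (T \<times> ball r \<times> T)"
    have "finite S" using T(1) finite_ball by (simp add: S_def)
    then have "finite ((\<lambda>n::int. z [^] n) -` S)" using inj by (rule finite_vimageI)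
    then have "bdd_above (abs ` ((\<lambda>n::int. z [^] n) -` S))" by (intro bdd_above_finite finite_imageI)
    then obtain K where K: "\<And>n. z [^] n \<in> S \<Longrightarrow> \<bar>n\<bar> \<le> (K::int)"
      unfolding bdd_above_def by (metis imageI vimageI)
    have "\<bar>\<phi> g - \<phi> h\<bar> \<le> max 0 K" if "near r g h" for g h
    proof -
      have gh: "g \<in> carrier G" "h \<in> carrier G" "inv g \<otimes> h \<in> ball r" using that by (auto simp: near_def)
      obtain t t' where t: "t \<in> T" "t' \<in> T" "g = z [^] \<phi> g \<otimes> t" "h = z [^] \<phi> h \<otimes> t'"
        using \<phi> gh by blast
      have tc: "t \<in> carrier G" "t' \<in> carrier G" using t T by auto
      have "z [^] (\<phi> h - \<phi> g) = inv (z [^] \<phi> g) \<otimes> z [^] \<phi> h"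
        using int_pow_mult[OF z, of "- \<phi> g" "\<phi> h"] z by (simp add: int_pow_neg)
      also have "\<dots> = inv (g \<otimes> inv t) \<otimes> (h \<otimes> inv t')"
        using t(3,4) tc z gh inv_solve_right[of "z [^] \<phi> g" g t] inv_solve_right[of "z [^] \<phi> h" h t'] by simp
      also have "\<dots> = t \<otimes> (inv g \<otimes> h) \<otimes> inv t'"
        using tc gh by (simp add: inv_mult_group m_assoc)
      also have "\<dots> \<in> S"
        unfolding S_def by (rule image_eqI[of _ _ "(t, inv g \<otimes> h, t')"]) (use t(1,2) gh in auto)
      finally have "\<bar>\<phi> h - \<phi> g\<bar> \<le> K" by (rule K)
      then show ?thesis by linarith
    qed
    then show "\<exists>K\<ge>0. \<forall>g h. near r g h \<longrightarrow> \<bar>\<phi> g - \<phi> h\<bar> \<le> K"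
      by (intro exI[of _ "max 0 K"]) auto
  next
    fix K :: int
    define S where "S = (\<lambda>(t, n, t'). inv t \<otimes> z [^] (n::int) \<otimes> t') ` (T \<times> {-K..K} \<times> T)"
    have "finite S" "S \<subseteq> carrier G" using T z by (auto simp: S_def)
    then obtain r where r: "S \<subseteq> ball r" using finite_subset_ball by blast
    have "near r g h" if gh: "g \<in> carrier G" "h \<in> carrier G" "\<bar>\<phi> g - \<phi> h\<bar> \<le> K" for g h
    proof -
      obtain t t' where t: "t \<in> T" "t' \<in> T" "g = z [^] \<phi> g \<otimes> t" "h = z [^] \<phi> h \<otimes> t'"
        using \<phi> gh by blast
      have tc: "t \<in> carrier G" "t' \<in> carrier G" using t T by auto
      have "inv g \<otimes> h = inv (z [^] \<phi> g \<otimes> t) \<otimes> (z [^] \<phi> h \<otimes> t')" using t(3,4) by simp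
      also have "\<dots> = inv t \<otimes> (inv (z [^] \<phi> g) \<otimes> z [^] \<phi> h) \<otimes> t'"
        using tc z by (simp add: inv_mult_group m_assoc)
      also have "inv (z [^] \<phi> g) \<otimes> z [^] \<phi> h = z [^] (\<phi> h - \<phi> g)"
        using int_pow_mult[OF z, of "- \<phi> g" "\<phi> h"] z by (simp add: int_pow_neg)
      also have "inv t \<otimes> z [^] (\<phi> h - \<phi> g) \<otimes> t' \<in> S"
        using t(1,2) gh(3) by (force simp: S_def)
      finally show ?thesis using r gh by (auto simp: near_def)
    qed
    then show "\<exists>r. \<forall>g\<in>carrier G. \<forall>h\<in>carrier G. \<bar>\<phi> g - \<phi> h\<bar> \<le> K \<longrightarrow> near r g h" by blast
  qed
qed

text \<open>If \<open>\<phi>\<close> left the range spanned by the ends of \<open>\<gamma>\<close> for a long time, \<open>\<gamma>\<close> would pass twice close to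
  the same point. So up to a bounded piece, all values of \<open>\<phi>\<close> on \<open>\<gamma>\<close> lie in that range and are
  approximately attained on \<open>\<gamma>'\<close>.\<close>

lemma geodesics_fellow_travel:
  fixes \<phi> :: "'a \<Rightarrow> int"
  assumes "\<And>r. \<exists>K\<ge>0. \<forall>g h. near r g h \<longrightarrow> \<bar>\<phi> g - \<phi> h\<bar> \<le> K"
    and "\<And>K. \<exists>r. \<forall>g\<in>carrier G. \<forall>h\<in>carrier G. \<bar>\<phi> g - \<phi> h\<bar> \<le> K \<longrightarrow> near r g h"
  shows "\<exists>R. \<forall>\<gamma> N \<gamma>' N'. geodesic_path \<gamma> N \<longrightarrow> geodesic_path \<gamma>' N' \<longrightarrow>
    near k (\<gamma> 0) (\<gamma>' 0) \<longrightarrow> near k (\<gamma> N) (\<gamma>' N') \<longrightarrow> (\<forall>i\<le>N. near R (\<gamma> i) (\<gamma>' i))"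
proof -
  obtain K1 where K1: "K1 \<ge> 0" "\<And>g h. near 1 g h \<Longrightarrow> \<bar>\<phi> g - \<phi> h\<bar> \<le> K1"
    using assms(1)[of 1] by blast
  obtain Kk where Kk: "Kk \<ge> 0" "\<And>g h. near k g h \<Longrightarrow> \<bar>\<phi> g - \<phi> h\<bar> \<le> Kk"
    using assms(1)[of k] by blast
  \<comment> \<open>\<open>K1\<close> is the error of the discrete intermediate value argument,
    \<open>Kk\<close> the discrepancy of \<open>\<phi>\<close> at the ends.\<close>
  obtain D where D: "\<And>g h. g \<in> carrier G \<Longrightarrow> h \<in> carrier G \<Longrightarrow> \<bar>\<phi> g - \<phi> h\<bar> \<le> K1 + Kk \<Longrightarrow> near D g h"
    using assms(2)[of "K1 + Kk"] by blast
  \<comment> \<open>\<open>D + k\<close> leads to some point \<open>\<gamma>' j\<close>; the other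
    \<open>D + k + k\<close> pays for the time shift between \<open>j\<close> and
    \<open>i\<close>.\<close>
  have "near (D + k + k + (D + k)) (\<gamma> i) (\<gamma>' i)"
    if geo: "geodesic_path \<gamma> N" "geodesic_path \<gamma>' N'"
      and ends: "near k (\<gamma> 0) (\<gamma>' 0)" "near k (\<gamma> N) (\<gamma>' N')" and i: "i \<le> N" for \<gamma> N \<gamma>' N' i
  proof -
    have c: "\<gamma> j \<in> carrier G" "\<gamma>' j \<in> carrier G" for j
      using geo by (auto simp: geodesic_path_def near_def)
    have step: "\<bar>\<phi> (\<gamma> (Suc j)) - \<phi> (\<gamma> j)\<bar> \<le> K1" "\<bar>\<phi> (\<gamma>' (Suc j)) - \<phi> (\<gamma>' j)\<bar> \<le> K1" for j
      using geo K1(2)[OF near_sym] by (auto simp: geodesic_path_def)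
    note ivt = discrete_intermediate_value[OF _ K1(1)]
    have e: "\<bar>\<phi> (\<gamma> 0) - \<phi> (\<gamma>' 0)\<bar> \<le> Kk" "\<bar>\<phi> (\<gamma> N) - \<phi> (\<gamma>' N')\<bar> \<le> Kk"
      using Kk(2) ends by auto
    have "\<exists>j\<le>N'. near (D + k) (\<gamma> i) (\<gamma>' j)"
    proof -
      consider "i \<le> D" | "N \<le> i + D"
        | "\<phi> (\<gamma> 0) \<le> \<phi> (\<gamma> i) \<and> \<phi> (\<gamma> i) \<le> \<phi> (\<gamma> N) \<or> \<phi> (\<gamma> N) \<le> \<phi> (\<gamma> i) \<and> \<phi> (\<gamma> i) \<le> \<phi> (\<gamma> 0)"
      proof -
        \<comment> \<open>One of the three values lies between the other two. If it is an end value,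
          the path is close to that end at a time on the other side of \<open>i\<close>, so
          minimality puts \<open>i\<close> within \<open>D\<close> of it.\<close>
        consider "\<phi> (\<gamma> i) \<le> \<phi> (\<gamma> 0) \<and> \<phi> (\<gamma> 0) \<le> \<phi> (\<gamma> N) \<or> \<phi> (\<gamma> N) \<le> \<phi> (\<gamma> 0) \<and> \<phi> (\<gamma> 0) \<le> \<phi> (\<gamma> i)"
          | "\<phi> (\<gamma> 0) \<le> \<phi> (\<gamma> N) \<and> \<phi> (\<gamma> N) \<le> \<phi> (\<gamma> i) \<or> \<phi> (\<gamma> i) \<le> \<phi> (\<gamma> N) \<and> \<phi> (\<gamma> N) \<le> \<phi> (\<gamma> 0)"
          | "\<phi> (\<gamma> 0) \<le> \<phi> (\<gamma> i) \<and> \<phi> (\<gamma> i) \<le> \<phi> (\<gamma> N) \<or> \<phi> (\<gamma> N) \<le> \<phi> (\<gamma> i) \<and> \<phi> (\<gamma> i) \<le> \<phi> (\<gamma> 0)"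
          by linarith
        then show ?thesis
        proof cases
          case 1
          then obtain j where j: "i \<le> j" "j \<le> N" "\<bar>\<phi> (\<gamma> j) - \<phi> (\<gamma> 0)\<bar> \<le> K1"
            using ivt[of i N "\<lambda>j. \<phi> (\<gamma> j)" "\<phi> (\<gamma> 0)"] i step by auto
          then have "near D (\<gamma> 0) (\<gamma> j)" using c Kk(1) by (intro D) auto
          then have "j \<le> D" using geodesic_path_length[OF geo(1), of 0 j] j by simp
          then show ?thesis using j that by simp
        next
          case 2
          then obtain j where j: "j \<le> i" "\<bar>\<phi> (\<gamma> j) - \<phi> (\<gamma> N)\<bar> \<le> K1"
            using ivt[of 0 i "\<lambda>j. \<phi> (\<gamma> j)" "\<phi> (\<gamma> N)"] step by auto
          then have "near D (\<gamma> j) (\<gamma> N)" using c Kk(1) by (intro D) auto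
          then have "N \<le> j + D" using geodesic_path_length[OF geo(1), of j N] j i by simp
          then show ?thesis using j that by simp
        next
          case 3
          then show ?thesis using that by blast
        qed
      qed
      then show ?thesis
      proof cases
        case 1
        have "near i (\<gamma> 0) (\<gamma> i)" using geodesic_path_near[OF geo(1), of 0 i] by simp
        then have "near (i + k) (\<gamma> i) (\<gamma>' 0)" using near_trans[OF near_sym ends(1)] by simp
        then show ?thesis using 1 near_mono by (intro exI[of _ 0]) auto
      next
        case 2
        have "near (N - i + k) (\<gamma> i) (\<gamma>' N')"
          using near_trans[OF geodesic_path_near[OF geo(1) i] ends(2)] .
        moreover have "N - i + k \<le> D + k" using 2 by simp
        ultimately have "near (D + k) (\<gamma> i) (\<gamma>' N')" by (rule near_mono)
        then show ?thesis by blast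
      next
        case 3
        have "\<exists>j\<le>N'. \<bar>\<phi> (\<gamma> i) - \<phi> (\<gamma>' j)\<bar> \<le> K1 + Kk"
        proof -
          consider "\<bar>\<phi> (\<gamma> i) - \<phi> (\<gamma>' 0)\<bar> \<le> Kk" | "\<bar>\<phi> (\<gamma> i) - \<phi> (\<gamma>' N')\<bar> \<le> Kk"
            | "\<phi> (\<gamma>' 0) \<le> \<phi> (\<gamma> i) \<and> \<phi> (\<gamma> i) \<le> \<phi> (\<gamma>' N') \<or> \<phi> (\<gamma>' N') \<le> \<phi> (\<gamma> i) \<and> \<phi> (\<gamma> i) \<le> \<phi> (\<gamma>' 0)"
            using 3 e by linarith
          then show ?thesis
          proof cases
            case 1
            then show ?thesis using K1(1) by (intro exI[of _ 0]) auto
          next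
            case 2
            then show ?thesis using K1(1) by (intro exI[of _ N']) auto
          next
            case 3
            then obtain j where "j \<le> N'" "\<bar>\<phi> (\<gamma>' j) - \<phi> (\<gamma> i)\<bar> \<le> K1"
              using ivt[of 0 N' "\<lambda>j. \<phi> (\<gamma>' j)" "\<phi> (\<gamma> i)"] step by auto
            then show ?thesis using Kk(1) by (intro exI[of _ j]) auto
          qed
        qed
        then obtain j where "j \<le> N'" "near D (\<gamma> i) (\<gamma>' j)" using D c by blast
        then show ?thesis using near_mono by (intro exI[of _ j]) auto
      qed
    qed
    then obtain j where j: "j \<le> N'" "near (D + k) (\<gamma> i) (\<gamma>' j)" by blast
    \<comment> \<open>On a geodesic, time is distance from the start, and the starts are within
      \<open>k\<close>; so the times \<open>i\<close> and \<open>j\<close> differ by at most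
      \<open>D + k + k\<close>.\<close>
    have "near (k + (j + (D + k))) (\<gamma> 0) (\<gamma> i)"
      using near_trans[OF ends(1) near_trans[OF geodesic_path_near[OF geo(2), of 0 j] near_sym[OF j(2)]]]
      by simp
    then have ij: "i \<le> k + (j + (D + k))"
      using geodesic_path_length[OF geo(1), of 0 i] i by simp
    have "near (k + (i + (D + k))) (\<gamma>' 0) (\<gamma>' j)"
      using near_trans[OF near_sym[OF ends(1)] near_trans[OF geodesic_path_near[OF geo(1), of 0 i] j(2)]]
      by simp
    then have ji: "j \<le> k + (i + (D + k))"
      using geodesic_path_length[OF geo(2), of 0 j] j by simp
    have "near (D + k + k) (\<gamma>' j) (\<gamma>' i)"
    proof (cases "i \<le> j")
      case True
      then show ?thesis
        using near_mono[OF near_sym[OF geodesic_path_near[OF geo(2) True]]] ji by simp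
    next
      case False
      then show ?thesis
        using near_mono[OF geodesic_path_near[OF geo(2), of j i]] ij by simp
    qed
    from near_trans[OF j(2) this] show ?thesis by (simp add: algebra_simps)
  qed
  then show ?thesis by blast
qed

end

section \<open>Shortlex conjugacy normal forms\<close>

locale ordered_generated_group = generated_group +
  fixes r
  assumes linear_order: "linear_order_on X r"
begin

section \<open>The shortlex order and normal forms as minimal words\<close>

lemma shortlex_irrefl: "(w, w) \<notin> shortlex r"
  unfolding shortlex_def by (rule lenlex_irreflexive) simp

text \<open>Two words below each other would both be least in \<open>{v, w}\<close>, contrary to
  uniqueness.\<close>

lemma shortlex_asym:
  assumes "v \<in> lists X" "w \<in> lists X" "(v, w) \<in> shortlex r"
  shows "(w, v) \<notin> shortlex r"
proof
  assume "(w, v) \<in> shortlex r"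
  then have "is_shortlex_least r {v, w} v" "is_shortlex_least r {v, w} w" "v \<noteq> w"
    using assms(3) shortlex_irrefl by (auto simp: is_shortlex_least_def)
  then show False
    using ex1_shortlex_least[OF finite_gens linear_order, of "{v, w}"] assms(1,2) by blast
qed

lemma shortlex_length: "(v, w) \<in> shortlex r \<Longrightarrow> length v \<le> length w"
  by (simp add: shortlex_def lenlex_length)

lemma shortlex_shorter: "length v < length w \<Longrightarrow> (v, w) \<in> shortlex r"
  by (simp add: shortlex_def lenlex_conv)

text \<open>Exchanges an arbitrary smaller witness for a minimal one. When \<open>W\<close> contains
  all words for the values it represents, the new witness is geodesic.\<close>

lemma ex_shortlex_minimal:
  assumes "W \<subseteq> lists X" "v \<in> W" "w \<in> W" "(v, w) \<in> shortlex r"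
  obtains v' where "v' \<in> W" "(v', w) \<in> shortlex r" "\<And>u. u \<in> W \<Longrightarrow> (u, v') \<notin> shortlex r"
proof -
  obtain v' where v': "is_shortlex_least r W v'"
    using ex1_shortlex_least[OF finite_gens linear_order assms(1)] assms(2) by blast
  then have least: "v' \<in> W" "\<And>u. u \<in> W \<Longrightarrow> u \<noteq> v' \<Longrightarrow> (v', u) \<in> shortlex r"
    by (auto simp: is_shortlex_least_def)
  have min: "(u, v') \<notin> shortlex r" if "u \<in> W" for u
    using least that assms(1) shortlex_asym[of v' u] shortlex_irrefl by blast
  then have "v' \<noteq> w" using assms by blast
  then show ?thesis using that least min assms(3) by blast
qed

lemma geodesic_wordI:
  assumes "w \<in> lists X" "\<And>v. v \<in> lists X \<Longrightarrow> val v = val w \<Longrightarrow> (v, w) \<notin> shortlex r"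
  shows "geodesic_word w"
  using assms shortlex_shorter unfolding geodesic_word_def by (meson not_le)

lemma conj_class_conj:
  assumes "g \<in> carrier G" "x \<in> carrier G"
  shows "conj_class G (x \<otimes> g \<otimes> inv x) = conj_class G g"
proof -
  have sub: "conj_class G (y \<otimes> h \<otimes> inv y) \<subseteq> conj_class G h"
    if "h \<in> carrier G" "y \<in> carrier G" for h y
  proof
    fix k assume "k \<in> conj_class G (y \<otimes> h \<otimes> inv y)"
    then obtain u where u: "u \<in> carrier G" "k = u \<otimes> (y \<otimes> h \<otimes> inv y) \<otimes> inv u"
      by (auto simp: conj_class_def)
    then have "k = (u \<otimes> y) \<otimes> h \<otimes> inv (u \<otimes> y)"
      using that by (simp add: inv_mult_group m_assoc)
    then show "k \<in> conj_class G h" using u(1) that unfolding conj_class_def by blast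
  qed
  have "g = inv x \<otimes> (x \<otimes> g \<otimes> inv x) \<otimes> inv (inv x)"
    using assms by (simp add: m_assoc mult_inv_mult_cancel)
  then have "conj_class G g \<subseteq> conj_class G (x \<otimes> g \<otimes> inv x)"
    using sub[of "x \<otimes> g \<otimes> inv x" "inv x"] assms by simp
  then show ?thesis using sub[OF assms] by blast
qed

lemma conj_nf_least:
  assumes "g \<in> carrier G"
  shows "is_shortlex_least r {v \<in> lists X. val v \<in> conj_class G g} (conj_nf G X r (conj_class G g))"
  by (rule is_shortlex_least_conj_nf[OF is_group finite_gens inverse_closed linear_order])
    (use assms in \<open>simp add: conj_classes_def\<close>)

lemma ConjSL_conj_nf:
  assumes "w \<in> ConjSL G X r"
  shows "w \<in> lists X" "w = conj_nf G X r (conj_class G (val w))"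
proof -
  obtain g where g: "g \<in> carrier G" "w = conj_nf G X r (conj_class G g)"
    using assms by (auto simp: ConjSL_def conj_classes_def)
  then have w: "w \<in> lists X" "val w \<in> conj_class G g"
    using conj_nf_least[OF g(1)] by (simp_all add: is_shortlex_least_def)
  then show "w \<in> lists X" by simp
  obtain x where "x \<in> carrier G" "val w = x \<otimes> g \<otimes> inv x"
    using w(2) by (auto simp: conj_class_def)
  then show "w = conj_nf G X r (conj_class G (val w))"
    using g conj_class_conj by simp
qed

text \<open>Replaces the definite description by the absence of a smaller conjugate word, a
  condition that a single witness refutes.\<close>

lemma ConjSL_iff:
  "w \<in> ConjSL G X r \<longleftrightarrow> w \<in> lists X \<and>
     (\<forall>v\<in>lists X. \<forall>x\<in>carrier G. val v = x \<otimes> val w \<otimes> inv x \<longrightarrow> (v, w) \<notin> shortlex r)"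
  (is "?L \<longleftrightarrow> ?R")
proof
  assume L: ?L
  then have w: "w \<in> lists X" "w = conj_nf G X r (conj_class G (val w))"
    by (rule ConjSL_conj_nf)+
  have least: "is_shortlex_least r {v \<in> lists X. val v \<in> conj_class G (val w)} w"
    using conj_nf_least[of "val w"] w by simp
  have "(v, w) \<notin> shortlex r"
    if v: "v \<in> lists X" "x \<in> carrier G" "val v = x \<otimes> val w \<otimes> inv x" for v x
  proof (cases "v = w")
    case False
    have "val v \<in> conj_class G (val w)" using v unfolding conj_class_def by blast
    then have "(w, v) \<in> shortlex r" using least v(1) False by (auto simp: is_shortlex_least_def)
    then show ?thesis by (rule shortlex_asym[OF w(1) v(1)])
  qed (simp add: shortlex_irrefl)
  with w(1) show ?R by blast
next
  assume R: ?R
  then have wc: "val w \<in> carrier G" by simp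
  define v where "v = conj_nf G X r (conj_class G (val w))"
  have least: "is_shortlex_least r {v \<in> lists X. val v \<in> conj_class G (val w)} v"
    unfolding v_def by (rule conj_nf_least[OF wc])
  then obtain x where "v \<in> lists X" "x \<in> carrier G" "val v = x \<otimes> val w \<otimes> inv x"
    by (auto simp: is_shortlex_least_def conj_class_def)
  then have "(v, w) \<notin> shortlex r" using R by blast
  moreover have "val w \<in> conj_class G (val w)"
    unfolding conj_class_def using wc by (auto intro!: exI[of _ \<one>])
  ultimately have "w = v"
    using least R by (auto simp: is_shortlex_least_def)
  then show ?L unfolding ConjSL_def conj_classes_def using wc by (auto simp: v_def)
qed

text \<open>The element leading from the end of the path of \<open>w\<close> to the end of the path
  of \<open>v\<close> started at \<open>t\<close>. For words over \<open>X\<close> and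
  \<open>t\<close> in the group, \<open>disp t w v = t\<close> means
  \<open>val v = inv t \<otimes> val w \<otimes> t\<close>.\<close>

definition disp :: "'a \<Rightarrow> 'a list \<Rightarrow> 'a list \<Rightarrow> 'a" where
  "disp t w v = inv (val w) \<otimes> (t \<otimes> val v)"

text \<open>A witness \<open>v\<close> represents \<open>t\<^sup>-\<^sup>1 w t\<close>, and its path starts at \<open>t\<close>. Such a \<open>v\<close> can be searched letter
  by letter, remembering only the bounded displacement of its path from that of \<open>w\<close>.\<close>

definition beaten :: "'a \<Rightarrow> nat \<Rightarrow> 'a list set" where
  "beaten t R = {w \<in> lists X. \<exists>v\<in>lists X. (v, w) \<in> shortlex r \<and>
     (\<forall>i\<le>length w. disp t (take i w) (take i v) \<in> ball R) \<and> disp t w v = t}"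

text \<open>The update uses only the old displacement and the new letters, so displacements can be
  automaton states. The first rule serves a \<open>v\<close> that has already ended.\<close>

lemma disp_snoc:
  assumes "u \<in> lists X" "v \<in> lists X" "a \<in> X" "t \<in> carrier G"
  shows "disp t (u @ [a]) v = inv a \<otimes> disp t u v"
    and "b \<in> X \<Longrightarrow> disp t (u @ [a]) (v @ [b]) = inv a \<otimes> disp t u v \<otimes> b"
  using assms gens_closed
  by (simp_all add: disp_def inv_mult_group m_assoc del: in_lists_conv_set)

text \<open>Subset construction: the state collects the observations of all candidates at once. It
  is a subset of \<open>ball R\<close> times flags, so there are finitely many states.\<close>

lemma regular_lang_beaten:
  assumes t: "t \<in> carrier G"
  shows "regular_lang X (beaten t R)"
proof -
  define good where "good u v \<longleftrightarrow> v \<in> lists X \<and> length v \<le> length u \<and>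
    (\<forall>i\<le>length u. disp t (take i u) (take i v) \<in> ball R)" for u v
  \<comment> \<open>Equality with \<open>u\<close> is needed to decide the order after one more
    letter, equal length to tell which candidates may still grow.\<close>
  define obs where "obs u v = (disp t u v, (v, u) \<in> shortlex r, v = u, length v = length u)" for u v
  define S where "S u = obs u ` {v. good u v}" for u
  have "S u \<subseteq> ball R \<times> UNIV" for u
  proof -
    have "disp t u v \<in> ball R" if "good u v" for v
      using that unfolding good_def by (metis le_refl take_all)
    then show ?thesis by (auto simp: S_def obs_def)
  qed
  then have "S ` lists X \<subseteq> Pow (ball R \<times> UNIV)" by blast
  then have fin: "finite (S ` lists X)"
    by (rule finite_subset) (simp add: finite_ball)
  have step: "S (u @ [a]) \<subseteq> S (u' @ [a])"
    if u: "u \<in> lists X" "u' \<in> lists X" "a \<in> X" and eq: "S u = S u'" for u u' a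
  proof
    fix q assume "q \<in> S (u @ [a])"
    then obtain v where v: "good (u @ [a]) v" "q = obs (u @ [a]) v" by (auto simp: S_def)
    then have vX: "v \<in> lists X" by (simp add: good_def)
    have di: "disp t (take i (u @ [a])) (take i v) \<in> ball R" if "i \<le> Suc (length u)" for i
      using v(1) that by (simp add: good_def)
    from di[of "Suc (length u)"] v(1) have last: "disp t (u @ [a]) v \<in> ball R"
      by (simp add: good_def)
    \<comment> \<open>The candidate cut back to the length of \<open>u\<close>; it is
      \<open>v\<close> itself if \<open>v\<close> has already stopped.\<close>
    define v0 where "v0 = take (length u) v"
    have v0X: "v0 \<in> lists X" using vX by (simp add: v0_def del: in_lists_conv_set)
    have "disp t (take i u) (take i v0) \<in> ball R" if "i \<le> length u" for i
      using di[of i] that by (simp add: v0_def min_def)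
    then have "good u v0" using v0X by (simp add: good_def v0_def del: in_lists_conv_set)
    then have "obs u v0 \<in> S u'" using eq by (auto simp: S_def)
    then obtain v' where v': "good u' v'" "obs u' v' = obs u v0" by (auto simp: S_def)
    then have v'X: "v' \<in> lists X" and v'len: "length v' \<le> length u'"
      and v'i: "\<And>i. i \<le> length u' \<Longrightarrow> disp t (take i u') (take i v') \<in> ball R"
      by (auto simp: good_def simp del: in_lists_conv_set)
    have o: "disp t u' v' = disp t u v0" "(v', u') \<in> shortlex r \<longleftrightarrow> (v0, u) \<in> shortlex r"
      "v' = u' \<longleftrightarrow> v0 = u" "length v' = length u' \<longleftrightarrow> length v0 = length u"
      using v'(2) by (simp_all add: obs_def)
    show "q \<in> S (u' @ [a])"
    proof (cases "length v \<le> length u")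
      case True
      then have v0: "v0 = v" by (simp add: v0_def)
      have d: "disp t (u' @ [a]) v' = disp t (u @ [a]) v"
        using u v'X vX t o(1) by (simp add: disp_snoc v0 del: in_lists_conv_set)
      have "disp t (take i (u' @ [a])) (take i v') \<in> ball R" if "i \<le> Suc (length u')" for i
        using that v'i[of i] v'len d last by (cases "i = Suc (length u')") auto
      then have "good (u' @ [a]) v'" using v'X v'len by (simp add: good_def del: in_lists_conv_set)
      \<comment> \<open>A candidate that has stopped is shorter than the input, hence smaller,
        unequal and of different length, whatever the old flags were.\<close>
      moreover have "obs (u' @ [a]) v' = q"
        using d True v'len shortlex_shorter[of v "u @ [a]"] shortlex_shorter[of v' "u' @ [a]"]
        by (auto simp: v(2) obs_def)
      ultimately show ?thesis by (auto simp: S_def)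
    next
      case False
      then have len: "length v = Suc (length u)" using v(1) by (simp add: good_def)
      define b where "b = v ! length u"
      have vb: "v = v0 @ [b]" using len by (simp add: v0_def b_def flip: take_Suc_conv_app_nth)
      then have b: "b \<in> X" using vX by simp
      have l: "length v0 = length u" using len by (simp add: v0_def)
      then have l': "length v' = length u'" using o(4) by simp
      have d: "disp t (u' @ [a]) (v' @ [b]) = disp t (u @ [a]) v"
        using u v'X v0X b t o(1) by (simp add: disp_snoc(2) vb del: in_lists_conv_set)
      have "disp t (take i (u' @ [a])) (take i (v' @ [b])) \<in> ball R" if "i \<le> Suc (length u')" for i
        using that v'i[of i] l' d last by (cases "i = Suc (length u')") auto
      then have "good (u' @ [a]) (v' @ [b])"
        using v'X l' b by (simp add: good_def del: in_lists_conv_set)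
      moreover have "obs (u' @ [a]) (v' @ [b]) = q"
        using d l l' o by (auto simp: v(2) obs_def vb shortlex_def lenlex_snoc_iff)
      ultimately show ?thesis by (auto simp: S_def)
    qed
  qed
  have "regular_lang X {w \<in> lists X. \<exists>e l. (t, True, e, l) \<in> S w}"
  proof (rule regular_lang_invariant[where S = S and P = "\<lambda>q. \<exists>e l. (t, True, e, l) \<in> q"])
    show "S (u @ [a]) = S (v @ [a])"
      if "u \<in> lists X" "v \<in> lists X" "a \<in> X" "S u = S v" for u v a
      using step[of u v a] step[of v u a] that by blast
  qed (use finite_gens fin in auto)
  also have "{w \<in> lists X. \<exists>e l. (t, True, e, l) \<in> S w} = beaten t R"
    unfolding beaten_def
  proof (intro Collect_cong conj_cong refl iffI)
    fix w assume "\<exists>e l. (t, True, e, l) \<in> S w"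
    then obtain v where "good w v" "disp t w v = t" "(v, w) \<in> shortlex r"
      by (auto simp: S_def obs_def)
    then show "\<exists>v\<in>lists X. (v, w) \<in> shortlex r \<and>
        (\<forall>i\<le>length w. disp t (take i w) (take i v) \<in> ball R) \<and> disp t w v = t"
      unfolding good_def by blast
  next
    fix w assume "\<exists>v\<in>lists X. (v, w) \<in> shortlex r \<and>
        (\<forall>i\<le>length w. disp t (take i w) (take i v) \<in> ball R) \<and> disp t w v = t"
    then obtain v where "good w v" "disp t w v = t" "(v, w) \<in> shortlex r"
      unfolding good_def using shortlex_length by blast
    then have "(t, True, v = w, length v = length w) = obs w v" "obs w v \<in> S w"
      unfolding S_def by (simp add: obs_def, intro imageI CollectI)
    then show "\<exists>e l. (t, True, e, l) \<in> S w" by metis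
  qed
  finally show ?thesis .
qed

section \<open>Beaten words versus normal forms\<close>

lemma beaten_not_ConjSL:
  assumes "take n w \<in> beaten \<one> R" "w \<in> lists X"
  shows "w \<notin> ConjSL G X r"
proof -
  obtain v where v: "v \<in> lists X" "(v, take n w) \<in> shortlex r" "disp \<one> (take n w) v = \<one>"
    using assms(1) by (auto simp: beaten_def simp del: in_lists_conv_set)
  have "val v = val (take n w)"
  proof -
    have "val (take n w) \<otimes> disp \<one> (take n w) v = val v"
      using v(1) assms(2) by (simp add: disp_def mult_inv_mult_cancel del: in_lists_conv_set)
    then show ?thesis using v(3) assms(2) by (simp del: in_lists_conv_set)
  qed
  then have "val (v @ drop n w) = val (take n w @ drop n w)"
    using v(1) assms(2) by (simp del: in_lists_conv_set append_take_drop_id)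
  then have "val (v @ drop n w) = \<one> \<otimes> val w \<otimes> inv \<one>"
    using assms(2) by simp
  \<comment> \<open>Appending a common tail preserves the order, so a smaller prefix makes the whole
    word smaller.\<close>
  moreover have "(v @ drop n w, take n w @ drop n w) \<in> shortlex r"
    using v(2) unfolding shortlex_def by (rule lenlex_append1) simp
  then have "(v @ drop n w, w) \<in> shortlex r" by simp
  moreover have "v @ drop n w \<in> lists X"
    using v(1) assms(2) by (metis append_in_lists_conv drop_lists)
  ultimately show ?thesis unfolding ConjSL_iff by blast
qed

text \<open>The witness represents a conjugate of \<open>val w\<close>. As for prefixes, any
  \<open>R\<close> will do; the width matters only in the converse.\<close>

lemma beaten_conj_not_ConjSL:
  assumes "w \<in> beaten t R" "t \<in> carrier G"
  shows "w \<notin> ConjSL G X r"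
proof -
  obtain v where v: "w \<in> lists X" "v \<in> lists X" "(v, w) \<in> shortlex r" "disp t w v = t"
    using assms(1) by (auto simp: beaten_def simp del: in_lists_conv_set)
  have "inv t \<otimes> (val w \<otimes> disp t w v) = val v"
    using v(1,2) assms(2) by (simp add: disp_def mult_inv_mult_cancel del: in_lists_conv_set)
  then have "val v = inv t \<otimes> val w \<otimes> inv (inv t)"
    using v assms(2) by (simp add: m_assoc del: in_lists_conv_set)
  then show ?thesis
    unfolding ConjSL_iff using v(2,3) assms(2) inv_closed by blast
qed

lemma near_disp: "near R (val w) (t \<otimes> val v) \<Longrightarrow> disp t w v \<in> ball R"
  by (simp add: near_def disp_def)

text \<open>In both cases the compared paths are geodesic with ends within \<open>k\<close>:
  \<open>1 \<le> k\<close> serves the letter after a geodesic prefix,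
  \<open>T \<subseteq> ball k\<close> the translation by \<open>t\<close>.\<close>

lemma not_ConjSL_beaten:
  assumes travel: "\<forall>\<gamma> N \<gamma>' N'. geodesic_path \<gamma> N \<longrightarrow> geodesic_path \<gamma>' N' \<longrightarrow>
      near k (\<gamma> 0) (\<gamma>' 0) \<longrightarrow> near k (\<gamma> N) (\<gamma>' N') \<longrightarrow> (\<forall>i\<le>N. near R (\<gamma> i) (\<gamma>' i))"
    and k: "1 \<le> k" "T \<subseteq> ball k"
    and z: "z \<in> carrier G"
    and dec: "\<And>g. g \<in> carrier G \<Longrightarrow> \<exists>n::int. \<exists>t\<in>T. g = z [^] n \<otimes> t"
    and w: "w \<in> lists X" "inv (val w) \<otimes> z \<otimes> val w = z" "w \<notin> ConjSL G X r"
  shows "(\<exists>n. take n w \<in> beaten \<one> R) \<or> (\<exists>t\<in>T. w \<in> beaten t R)"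
proof (cases "\<exists>v\<in>lists X. val v = val w \<and> (v, w) \<in> shortlex r")
  case True
  define red where "red n \<longleftrightarrow> (\<exists>v\<in>lists X. val v = val (take n w) \<and> (v, take n w) \<in> shortlex r)" for n
  have full: "red (length w)" using True by (simp add: red_def del: in_lists_conv_set)
  \<comment> \<open>The shortest reducible prefix: dropping its last letter leaves a geodesic
    word.\<close>
  define n where "n = (LEAST n. red n)"
  have n: "red n" "\<And>m. m < n \<Longrightarrow> \<not> red m" and "n \<le> length w"
    unfolding n_def by (rule LeastI[of red, OF full]) (fact not_less_Least Least_le[of red, OF full])+
  have "\<not> red 0" by (simp add: red_def shortlex_def)
  then obtain m where m: "n = Suc m" using n(1) by (cases n) auto
  define u where "u = take m w"
  define w' where "w' = take n w"
  define a where "a = w ! m"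
  have lenu: "length u = m" using \<open>n \<le> length w\<close> m by (simp add: u_def)
  have w': "w' = u @ [a]" using \<open>n \<le> length w\<close> m by (simp add: w'_def u_def a_def take_Suc_conv_app_nth)
  have X: "u \<in> lists X" "w' \<in> lists X" using w(1) by (simp_all add: u_def w'_def del: in_lists_conv_set)
  then have a: "a \<in> X" using w' by simp
  have geou: "geodesic_word u"
    using n(2)[of m] m X by (intro geodesic_wordI) (auto simp: red_def u_def simp del: in_lists_conv_set)
  obtain v0 where v0: "v0 \<in> lists X" "val v0 = val w'" "(v0, w') \<in> shortlex r"
    using n(1) by (auto simp: red_def w'_def simp del: in_lists_conv_set)
  obtain v where v: "v \<in> {v \<in> lists X. val v = val w'}" "(v, w') \<in> shortlex r"
    and vmin: "\<And>u. u \<in> {v \<in> lists X. val v = val w'} \<Longrightarrow> (u, v) \<notin> shortlex r"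
    by (rule ex_shortlex_minimal[of "{v \<in> lists X. val v = val w'}" v0 w']) (use v0 X in auto)
  have vX: "v \<in> lists X" "val v = val w'" using v by auto
  have geov: "geodesic_word v" using vX vmin by (intro geodesic_wordI) auto
  have ends: "near k (val u) (val v)"
  proof -
    have "[a] \<in> lists X" using a by simp
    then have "val [a] \<in> ball 1" by (rule ballI) simp
    then have "near 1 (val u) (val u \<otimes> a)"
      using X a gens_closed by (simp add: near_def mult_inv_mult_cancel del: in_lists_conv_set)
    moreover have "val v = val u \<otimes> a"
      using X a gens_closed vX(2) \<open>[a] \<in> lists X\<close> by (simp add: w' del: in_lists_conv_set)
    ultimately show ?thesis using near_mono k(1) by metis
  qed
  have "near R (\<one> \<otimes> val (take i u)) (\<one> \<otimes> val (take i v))" if "i \<le> m" for i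
    using that ends X vX near_mono[OF near_refl[OF one_closed], of k]
    by (intro travel[rule_format, OF geodesic_word_path[OF geou one_closed] geodesic_word_path[OF geov one_closed]])
      (simp_all add: lenu del: in_lists_conv_set)
  then have small: "disp \<one> (take i u) (take i v) \<in> ball R" if "i \<le> m" for i
    using that X vX by (intro near_disp) (simp del: in_lists_conv_set)
  have one: "disp \<one> w' v = \<one>"
    using X vX by (simp add: disp_def del: in_lists_conv_set)
  \<comment> \<open>Comparing \<open>u\<close> with \<open>v\<close> covers the times up to
    \<open>m\<close>; at the last time the paths of \<open>w'\<close> and \<open>v\<close>
    meet.\<close>
  have "disp \<one> (take i w') (take i v) \<in> ball R" if "i \<le> length w'" for i
  proof (cases "i \<le> m")
    case True
    then show ?thesis using small lenu by (simp add: w')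
  next
    case False
    then have "take i w' = w'" "take i v = v"
      using that shortlex_length[OF v(2)] lenu by (simp_all add: w')
    moreover have "\<one> \<in> ball R" using ballI[of "[]" R] by simp
    ultimately show ?thesis by (simp add: one)
  qed
  then have "w' \<in> beaten \<one> R"
    unfolding beaten_def using X vX v(2) one by blast
  then show ?thesis unfolding w'_def by blast
next
  case False
  then have geow: "geodesic_word w" using w(1) by (intro geodesic_wordI) auto
  define W where "W = {v \<in> lists X. \<exists>x\<in>carrier G. val v = x \<otimes> val w \<otimes> inv x}"
  have wc: "val w \<in> carrier G" using w(1) by simp
  have W: "W \<subseteq> lists X" unfolding W_def by blast
  have "val w = \<one> \<otimes> val w \<otimes> inv \<one>" using wc by simp
  then have wW: "w \<in> W" using w(1) one_closed unfolding W_def by blast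
  obtain v0 where "v0 \<in> W" "(v0, w) \<in> shortlex r"
    using w(1,3) unfolding ConjSL_iff[of w] W_def by blast
  then obtain v where v: "v \<in> W" "(v, w) \<in> shortlex r" "\<And>u. u \<in> W \<Longrightarrow> (u, v) \<notin> shortlex r"
    using ex_shortlex_minimal[OF W _ wW] by metis
  then obtain x where vX: "v \<in> lists X" and x: "x \<in> carrier G" "val v = x \<otimes> val w \<otimes> inv x"
    unfolding W_def by blast
  have geov: "geodesic_word v"
  proof (rule geodesic_wordI[OF vX])
    fix u assume "u \<in> lists X" "val u = val v"
    then have "u \<in> W" using x unfolding W_def by auto
    then show "(u, v) \<notin> shortlex r" by (rule v(3))
  qed
  \<comment> \<open>Decomposing \<open>inv x\<close> rather than \<open>x\<close> places
    \<open>z [^] n\<close> next to \<open>val w\<close> in the conjugate, where it cancels by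
    \<open>zn\<close>.\<close>
  obtain n :: int and t where t: "t \<in> T" "inv x = z [^] n \<otimes> t" using dec[of "inv x"] x by auto
  have tb: "t \<in> ball k" using t(1) k(2) by blast
  then have tc: "t \<in> carrier G" using ball_closed by blast
  have zn: "val w \<otimes> z [^] n = z [^] n \<otimes> val w"
  proof -
    have "inv (val w) \<otimes> z [^] n \<otimes> val w = z [^] n"
      using int_pow_conj[OF wc z, of n] w(2) by simp
    then have "val w \<otimes> (inv (val w) \<otimes> (z [^] n \<otimes> val w)) = val w \<otimes> z [^] n"
      using wc z by (simp add: m_assoc)
    then show ?thesis using wc z by (simp add: mult_inv_mult_cancel)
  qed
  have tv: "t \<otimes> val v = val w \<otimes> t"
  proof -
    have "x = inv t \<otimes> inv (z [^] n)"
      using t(2) x(1) z tc by (metis int_pow_closed inv_inv inv_mult_group)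
    then have "t \<otimes> val v = inv (z [^] n) \<otimes> (val w \<otimes> z [^] n) \<otimes> t"
      using t(2) wc z tc by (simp add: x(2) m_assoc mult_inv_mult_cancel)
    also have "\<dots> = val w \<otimes> t"
      using wc z tc by (simp add: zn m_assoc mult_inv_mult_cancel)
    finally show ?thesis .
  qed
  \<comment> \<open>The starts are \<open>\<one>\<close> and \<open>t\<close>, the ends
    \<open>val w\<close> and \<open>t \<otimes> val v = val w \<otimes> t\<close>: both pairs differ
    by \<open>t\<close>.\<close>
  have "near R (\<one> \<otimes> val (take i w)) (t \<otimes> val (take i v))" if "i \<le> length w" for i
    using that tb tc tv wc w(1) vX
    by (intro travel[rule_format, OF geodesic_word_path[OF geow one_closed] geodesic_word_path[OF geov tc]])
      (simp_all add: near_def mult_inv_mult_cancel del: in_lists_conv_set)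
  then have "disp t (take i w) (take i v) \<in> ball R" if "i \<le> length w" for i
    using that w(1) by (intro near_disp) (simp del: in_lists_conv_set)
  moreover have "disp t w v = t"
    using tv tc wc by (simp add: disp_def mult_inv_mult_cancel)
  ultimately have "w \<in> beaten t R"
    unfolding beaten_def using w(1) vX v(2) by blast
  then show ?thesis using t(1) by blast
qed

text \<open>The conjugate of \<open>z\<close> by the prefix read so far is \<open>z\<close> or
  \<open>inv z\<close>, and each letter acts on it by conjugation; these values are the
  states.\<close>

lemma regular_lang_centralizer:
  assumes z: "z \<in> carrier G" "\<And>g. g \<in> carrier G \<Longrightarrow> inv g \<otimes> z \<otimes> g \<in> {z, inv z}"
  shows "regular_lang X {w \<in> lists X. inv (val w) \<otimes> z \<otimes> val w = z}"
proof (rule regular_lang_invariant[where S = "\<lambda>w. inv (val w) \<otimes> z \<otimes> val w" and P = "\<lambda>y. y = z"])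
  have "(\<lambda>w. inv (val w) \<otimes> z \<otimes> val w) ` lists X \<subseteq> {z, inv z}"
    using z(2) val_closed by blast
  then show "finite ((\<lambda>w. inv (val w) \<otimes> z \<otimes> val w) ` lists X)"
    by (rule finite_subset) simp
next
  fix u v a assume uv: "u \<in> lists X" "v \<in> lists X" "a \<in> X"
    "inv (val u) \<otimes> z \<otimes> val u = inv (val v) \<otimes> z \<otimes> val v"
  have "inv (val (u @ [a])) \<otimes> z \<otimes> val (u @ [a]) = inv a \<otimes> (inv (val u) \<otimes> z \<otimes> val u) \<otimes> a"
    if "u \<in> lists X" for u
  proof -
    have "val (u @ [a]) = val u \<otimes> a"
      using that uv(3) gens_closed val_append[of u "[a]"] by simp
    then show ?thesis
      using that uv(3) gens_closed z(1) by (simp add: inv_mult_group m_assoc del: in_lists_conv_set)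
  qed
  then show "inv (val (u @ [a])) \<otimes> z \<otimes> val (u @ [a]) = inv (val (v @ [a])) \<otimes> z \<otimes> val (v @ [a])"
    using uv by simp
qed (rule finite_gens)

text \<open>If \<open>g\<close> inverts \<open>z\<close>, then \<open>z\<^sup>k g z\<^sup>-\<^sup>k = z\<^sup>2\<^sup>k g\<close>.\<close>

lemma finite_ConjSL_outside_centralizer:
  assumes z: "z \<in> carrier G" and T: "finite T" "T \<subseteq> carrier G"
    and dec: "\<And>g. g \<in> carrier G \<Longrightarrow> \<exists>n::int. \<exists>t\<in>T. g = z [^] n \<otimes> t"
    and inv: "\<And>g. g \<in> carrier G \<Longrightarrow> inv g \<otimes> z \<otimes> g \<in> {z, inv z}"
  shows "finite {w \<in> ConjSL G X r. inv (val w) \<otimes> z \<otimes> val w \<noteq> z}"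
proof (rule finite_subset)
  define S where "S = (\<lambda>(i::int, t). z [^] i \<otimes> t) ` ({0, 1} \<times> T)"
  show "finite ((\<lambda>g. conj_nf G X r (conj_class G g)) ` S)"
    using T(1) by (simp add: S_def)
  show "{w \<in> ConjSL G X r. inv (val w) \<otimes> z \<otimes> val w \<noteq> z} \<subseteq> (\<lambda>g. conj_nf G X r (conj_class G g)) ` S"
  proof clarify
    fix w assume w: "w \<in> ConjSL G X r" "inv (val w) \<otimes> z \<otimes> val w \<noteq> z"
    define g where "g = val w"
    have g: "g \<in> carrier G" using ConjSL_conj_nf(1)[OF w(1)] by (simp add: g_def)
    have gz: "inv g \<otimes> z \<otimes> g = inv z" using inv[OF g] w(2) by (simp add: g_def)
    obtain n :: int and t where t: "t \<in> T" "g = z [^] n \<otimes> t" using dec[OF g] by blast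
    have tc: "t \<in> carrier G" using t(1) T(2) by blast
    \<comment> \<open>Conjugation by \<open>z [^] k\<close> adds \<open>2 * k\<close> to the
      exponent \<open>n\<close>, so this choice leaves \<open>n mod 2\<close>, that is 0 or
      1.\<close>
    define k where "k = - (n div 2)"
    have "inv g \<otimes> z [^] k \<otimes> g = inv (z [^] k)"
      using int_pow_conj[OF g z, of k] z gz by (simp add: int_pow_inv)
    then have "g \<otimes> (inv g \<otimes> (z [^] k \<otimes> g)) = g \<otimes> inv (z [^] k)"
      using g z by (simp add: m_assoc)
    then have comm: "z [^] k \<otimes> g = g \<otimes> inv (z [^] k)"
      using g z by (simp add: mult_inv_mult_cancel)
    have "z [^] k \<otimes> g \<otimes> inv (z [^] k) = z [^] k \<otimes> (g \<otimes> inv (z [^] k))"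
      using g z by (simp add: m_assoc)
    also have "\<dots> = z [^] k \<otimes> (z [^] k \<otimes> g)" by (simp only: comm)
    also have "\<dots> = z [^] (k + (k + n)) \<otimes> t"
      using z tc int_pow_mult[OF z, of k "k + n"] int_pow_mult[OF z, of k n]
      by (simp add: t(2) m_assoc)
    also have "k + (k + n) = n mod 2" by (simp add: k_def minus_mult_div_eq_mod[symmetric])
    finally have "conj_class G g = conj_class G (z [^] (n mod 2) \<otimes> t)"
      using conj_class_conj[OF g, of "z [^] k"] z by simp
    moreover have "z [^] (n mod 2) \<otimes> t \<in> S"
      unfolding S_def using t(1) by (intro image_eqI[of _ _ "(n mod 2, t)"]) auto
    ultimately show "w \<in> (\<lambda>g. conj_nf G X r (conj_class G g)) ` S"
      using ConjSL_conj_nf(2)[OF w(1)] by (auto simp: g_def)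
  qed
qed

lemma regular_lang_ConjSL:
  assumes "virtually_cyclic G"
  shows "regular_lang X (ConjSL G X r)"
proof -
  obtain z T where z: "z \<in> carrier G" and T: "finite T" "T \<subseteq> carrier G"
    and dec: "\<And>g. g \<in> carrier G \<Longrightarrow> \<exists>n::int. \<exists>t\<in>T. g = z [^] n \<otimes> t"
    and inv: "\<And>g. g \<in> carrier G \<Longrightarrow> inv g \<otimes> z \<otimes> g \<in> {z, inv z}"
    and inj: "finite (carrier G) \<or> inj (\<lambda>n::int. z [^] n)"
    using virtually_cyclic_structure[OF assms] by metis
  obtain k0 where "T \<subseteq> ball k0" using finite_subset_ball[OF T] by blast
  moreover define k where "k = max 1 k0"
  ultimately have k: "1 \<le> k" "T \<subseteq> ball k" using ball_mono[of k0 k] by auto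
  obtain \<phi> :: "'a \<Rightarrow> int"
    where \<phi>: "\<And>r. \<exists>K\<ge>0. \<forall>g h. near r g h \<longrightarrow> \<bar>\<phi> g - \<phi> h\<bar> \<le> K"
      "\<And>K. \<exists>r. \<forall>g\<in>carrier G. \<forall>h\<in>carrier G. \<bar>\<phi> g - \<phi> h\<bar> \<le> K \<longrightarrow> near r g h"
    using quasi_isometry_to_int[OF z T dec inj] by metis
  obtain R where R: "\<forall>\<gamma> N \<gamma>' N'. geodesic_path \<gamma> N \<longrightarrow> geodesic_path \<gamma>' N' \<longrightarrow>
      near k (\<gamma> 0) (\<gamma>' 0) \<longrightarrow> near k (\<gamma> N) (\<gamma>' N') \<longrightarrow> (\<forall>i\<le>N. near R (\<gamma> i) (\<gamma>' i))"
    using geodesics_fellow_travel[OF \<phi>, of k] by blast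
  define C where "C = {w \<in> lists X. inv (val w) \<otimes> z \<otimes> val w = z}"
  define P where "P = {w \<in> lists X. \<exists>n. take n w \<in> beaten \<one> R}"
  define B where "B = (\<Union>t\<in>T. beaten t R)"
  define E where "E = {w \<in> ConjSL G X r. inv (val w) \<otimes> z \<otimes> val w \<noteq> z}"
  have "regular_lang X C"
    unfolding C_def by (rule regular_lang_centralizer[OF z inv])
  moreover have "regular_lang X P"
    unfolding P_def by (intro regular_lang_some_prefix regular_lang_beaten one_closed)
  moreover have "regular_lang X B"
    unfolding B_def using T finite_gens
    by (intro regular_lang_UN regular_lang_beaten) (auto simp: beaten_def)
  moreover have "regular_lang X E"
    using finite_ConjSL_outside_centralizer[OF z T dec inv] finite_gens ConjSL_conj_nf(1)
    by (intro regular_lang_finite) (auto simp: E_def)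
  \<comment> \<open>Inside \<open>C\<close> the beaten words are removed; outside \<open>C\<close>
    the finite set \<open>E\<close> supplies all normal forms.\<close>
  ultimately have "regular_lang X {w \<in> lists X. w \<in> {w \<in> lists X. w \<in> C \<and> w \<notin>
      {w \<in> lists X. w \<in> P \<or> w \<in> B}} \<or> w \<in> E}"
    by (intro regular_lang_combine[where b = "(\<or>)"] regular_lang_combine[where b = "\<lambda>p q. p \<and> \<not> q"])
  also have "{w \<in> lists X. w \<in> {w \<in> lists X. w \<in> C \<and> w \<notin>
      {w \<in> lists X. w \<in> P \<or> w \<in> B}} \<or> w \<in> E} = ConjSL G X r"
  proof -
    have "w \<in> ConjSL G X r \<longleftrightarrow> w \<notin> P \<and> w \<notin> B" if "w \<in> C" for w
      using that not_ConjSL_beaten[OF R k z dec, of w] beaten_not_ConjSL[of _ w R]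
        beaten_conj_not_ConjSL[of w _ R] T(2)
      unfolding C_def P_def B_def by blast
    then show ?thesis
      using ConjSL_conj_nf(1) unfolding C_def E_def by blast
  qed
  finally show ?thesis .
qed

end

theorem theorem4p2:
  fixes G :: "('a, 'b) monoid_scheme" and X :: "'a set" and r :: "('a \<times> 'a) set"
  assumes "group G"
    and "virtually_cyclic G"
    and "finite X"
    and "inverse_closed_gens G X"
    and "linear_order_on X r"
  shows "regular_lang X (ConjSL G X r) \<and>
         rational_fps (spherical_conj_growth_series G X r)"
proof -
  interpret group G by fact
  interpret ordered_generated_group G X r
    by unfold_locales fact+
  have "regular_lang X (ConjSL G X r)"
    using assms(2) by (rule regular_lang_ConjSL)
  then show ?thesis
    unfolding spherical_conj_growth_series_def by (blast intro: regular_lang_rational_growth)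
qed

end
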